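(* Let $f\colon X\to Y$ be a continuous map between finite topological spaces. For any $K\in D(Y)$ and any closed subset $C\subseteq Y$, one has a natural morphism $$f_C^\#(K_{\vert C})\to(f^\#K)_{\vert f^{-1}(C)},$$ where $f_C\colon f^{-1}(C)\to C$ is the restriction of $f$.
   Context: A finite topological space $X$ carries the preorder: $p\le q$ iff $\overline{\{p\}}\subseteq\overline{\{q\}}$; $C_p=\{q: q\le p\}$ is the closure of $p$. An abelian data $F$ on $X$ is a functor from the preordered set $X$ to abelian groups. $D(X)$ is the (unbounded) derived category of abelian data on $X$. For $f\colon X\to Y$ continuous: $(f^{-1}G)_x=G_{f(x)}$ (written $G_{\vert S}$ when $f$ is the inclusion of a subspace $S$), $(f_!F)_y=\varinjlim_{x\in f^{-1}(C_y)}F_x$, and $\mathbb{L}f_!$ is the left derived functor of $f_!$. The functor $\mathbb{L}f_!\colon D(X)\to D(Y)$ has a left adjoint, denoted $f^\#\colon D(Y)\to D(X)$; likewise $f_C^\#\colon D(C)\to D(f^{-1}(C))$ is the left adjoint of $\mathbb{L}(f_C)_!$. *)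

theory Defs
  imports "HOL-Algebra.Coset" "HOL-Analysis.Abstract_Topology"
begin

section \<open>Categories, functors, natural transformations\<close>

record ('o, 'm) category =
  Ob :: "'o set"
  Arr :: "'m set"
  Src :: "'m \<Rightarrow> 'o"
  Tgt :: "'m \<Rightarrow> 'o"
  Idn :: "'o \<Rightarrow> 'm"
  Comp :: "'m \<Rightarrow> 'm \<Rightarrow> 'm"

text \<open>\<open>Comp \<C> g f\<close> is the composite \<open>g \<circ> f\<close>; it is only meaningful if \<open>Tgt \<C> f = Src \<C> g\<close>.\<close>

definition Hom :: "('o, 'm) category \<Rightarrow> 'o \<Rightarrow> 'o \<Rightarrow> 'm set" where
  "Hom \<C> A B = {f \<in> Arr \<C>. Src \<C> f = A \<and> Tgt \<C> f = B}"

record ('o1, 'm1, 'o2, 'm2) cfunctor =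
  onOb :: "'o1 \<Rightarrow> 'o2"
  onArr :: "'m1 \<Rightarrow> 'm2"

definition is_functor ::
  "('o1, 'm1) category \<Rightarrow> ('o2, 'm2) category \<Rightarrow> ('o1, 'm1, 'o2, 'm2) cfunctor \<Rightarrow> bool" where
  "is_functor \<C> \<D> F \<longleftrightarrow>
     (\<forall>A\<in>Ob \<C>. onOb F A \<in> Ob \<D> \<and> onArr F (Idn \<C> A) = Idn \<D> (onOb F A)) \<and>
     (\<forall>A\<in>Ob \<C>. \<forall>B\<in>Ob \<C>. \<forall>f\<in>Hom \<C> A B. onArr F f \<in> Hom \<D> (onOb F A) (onOb F B)) \<and>
     (\<forall>A\<in>Ob \<C>. \<forall>B\<in>Ob \<C>. \<forall>C\<in>Ob \<C>. \<forall>f\<in>Hom \<C> A B. \<forall>g\<in>Hom \<C> B C.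
        onArr F (Comp \<C> g f) = Comp \<D> (onArr F g) (onArr F f))"

definition idF :: "('o, 'm, 'o, 'm) cfunctor" where
  "idF = \<lparr>onOb = (\<lambda>A. A), onArr = (\<lambda>f. f)\<rparr>"

definition compF ::
  "('o2, 'm2, 'o3, 'm3) cfunctor \<Rightarrow> ('o1, 'm1, 'o2, 'm2) cfunctor \<Rightarrow> ('o1, 'm1, 'o3, 'm3) cfunctor"
  (infixr "\<cdot>\<^sub>F" 75) where
  "G \<cdot>\<^sub>F F = \<lparr>onOb = (\<lambda>A. onOb G (onOb F A)), onArr = (\<lambda>f. onArr G (onArr F f))\<rparr>"

text \<open>Families of arrows are normalised to be \<open>undefined\<close> off the objects of the source category,
  so that equality of natural transformations is equality of functions.\<close>

definition nat_trans ::
  "('o1, 'm1) category \<Rightarrow> ('o2, 'm2) category \<Rightarrow> ('o1, 'm1, 'o2, 'm2) cfunctor \<Rightarrow>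
   ('o1, 'm1, 'o2, 'm2) cfunctor \<Rightarrow> ('o1 \<Rightarrow> 'm2) \<Rightarrow> bool" where
  "nat_trans \<C> \<D> F G \<tau> \<longleftrightarrow>
     \<tau> \<in> extensional (Ob \<C>) \<and>
     (\<forall>A\<in>Ob \<C>. \<tau> A \<in> Hom \<D> (onOb F A) (onOb G A)) \<and>
     (\<forall>A\<in>Ob \<C>. \<forall>B\<in>Ob \<C>. \<forall>f\<in>Hom \<C> A B.
        Comp \<D> (\<tau> B) (onArr F f) = Comp \<D> (onArr G f) (\<tau> A))"

text \<open>\<open>S : \<D> \<rightarrow> \<C>\<close> is left adjoint to \<open>R : \<C> \<rightarrow> \<D>\<close> with unit \<open>\<eta>\<close>.\<close>

definition is_left_adjoint ::
  "('o1, 'm1) category \<Rightarrow> ('o2, 'm2) category \<Rightarrow> ('o1, 'm1, 'o2, 'm2) cfunctor \<Rightarrow>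
   ('o2, 'm2, 'o1, 'm1) cfunctor \<Rightarrow> ('o2 \<Rightarrow> 'm2) \<Rightarrow> bool" where
  "is_left_adjoint \<C> \<D> R S \<eta> \<longleftrightarrow>
     is_functor \<C> \<D> R \<and> is_functor \<D> \<C> S \<and> nat_trans \<D> \<D> idF (R \<cdot>\<^sub>F S) \<eta> \<and>
     (\<forall>K\<in>Ob \<D>. \<forall>F\<in>Ob \<C>. \<forall>u\<in>Hom \<D> K (onOb R F).
        \<exists>!v. v \<in> Hom \<C> (onOb S K) F \<and> Comp \<D> (onArr R v) (\<eta> K) = u)"


section \<open>Localisation and derived functors\<close>

text \<open>Gabriel--Zisman localisation \<open>\<C>[W\<^sup>-\<^sup>1]\<close>: arrows \<open>A \<rightarrow> B\<close> are classes of zigzags from \<open>A\<close> to \<open>B\<close>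
  (read from left to right, \<open>Fwd f\<close> along \<open>f\<close>, \<open>Bwd s\<close> against \<open>s \<in> W\<close>) modulo the congruence
  generated by the composition of \<open>\<C>\<close> and by \<open>Bwd s\<close> being inverse to \<open>Fwd s\<close>.\<close>

datatype 'm zigzag_step = Fwd 'm | Bwd 'm

inductive zigzag :: "('o, 'm) category \<Rightarrow> 'm set \<Rightarrow> 'o \<Rightarrow> 'm zigzag_step list \<Rightarrow> 'o \<Rightarrow> bool"
  for \<C> W where
  zz_nil: "A \<in> Ob \<C> \<Longrightarrow> zigzag \<C> W A [] A"
| zz_fwd: "A \<in> Ob \<C> \<Longrightarrow> f \<in> Hom \<C> A B \<Longrightarrow> zigzag \<C> W B w C \<Longrightarrow> zigzag \<C> W A (Fwd f # w) C"
| zz_bwd: "A \<in> Ob \<C> \<Longrightarrow> s \<in> W \<Longrightarrow> s \<in> Hom \<C> B A \<Longrightarrow> zigzag \<C> W B w C \<Longrightarrow>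
           zigzag \<C> W A (Bwd s # w) C"

inductive zz_eq ::
  "('o, 'm) category \<Rightarrow> 'm set \<Rightarrow> 'o \<Rightarrow> 'o \<Rightarrow> 'm zigzag_step list \<Rightarrow> 'm zigzag_step list \<Rightarrow> bool"
  for \<C> W where
  zz_refl: "zigzag \<C> W A w B \<Longrightarrow> zz_eq \<C> W A B w w"
| zz_sym: "zz_eq \<C> W A B v w \<Longrightarrow> zz_eq \<C> W A B w v"
| zz_trans: "zz_eq \<C> W A B u v \<Longrightarrow> zz_eq \<C> W A B v w \<Longrightarrow> zz_eq \<C> W A B u w"
| zz_ctx: "zigzag \<C> W A u A' \<Longrightarrow> zz_eq \<C> W A' B' w w' \<Longrightarrow> zigzag \<C> W B' v B \<Longrightarrow>
           zz_eq \<C> W A B (u @ w @ v) (u @ w' @ v)"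
| zz_idn: "A \<in> Ob \<C> \<Longrightarrow> zz_eq \<C> W A A [Fwd (Idn \<C> A)] []"
| zz_comp: "A \<in> Ob \<C> \<Longrightarrow> B \<in> Ob \<C> \<Longrightarrow> C \<in> Ob \<C> \<Longrightarrow> f \<in> Hom \<C> A B \<Longrightarrow> g \<in> Hom \<C> B C \<Longrightarrow>
            zz_eq \<C> W A C [Fwd f, Fwd g] [Fwd (Comp \<C> g f)]"
| zz_inv1: "A \<in> Ob \<C> \<Longrightarrow> B \<in> Ob \<C> \<Longrightarrow> s \<in> W \<Longrightarrow> s \<in> Hom \<C> A B \<Longrightarrow> zz_eq \<C> W A A [Fwd s, Bwd s] []"
| zz_inv2: "A \<in> Ob \<C> \<Longrightarrow> B \<in> Ob \<C> \<Longrightarrow> s \<in> W \<Longrightarrow> s \<in> Hom \<C> A B \<Longrightarrow> zz_eq \<C> W B B [Bwd s, Fwd s] []"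

type_synonym ('o, 'm) loc_arr = "'o \<times> 'm zigzag_step list set \<times> 'o"

definition zz_class ::
  "('o, 'm) category \<Rightarrow> 'm set \<Rightarrow> 'o \<Rightarrow> 'o \<Rightarrow> 'm zigzag_step list \<Rightarrow> ('o, 'm) loc_arr" where
  "zz_class \<C> W A B w = (A, {w'. zz_eq \<C> W A B w w'}, B)"

definition localization :: "('o, 'm) category \<Rightarrow> 'm set \<Rightarrow> ('o, ('o, 'm) loc_arr) category" where
  "localization \<C> W =
     \<lparr>Ob = Ob \<C>,
      Arr = {zz_class \<C> W A B w | A B w. zigzag \<C> W A w B},
      Src = (\<lambda>(A, c, B). A),
      Tgt = (\<lambda>(A, c, B). B),
      Idn = (\<lambda>A. zz_class \<C> W A A []),
      Comp = (\<lambda>(B', c', C) (A, c, B). (A, {w. \<exists>u\<in>c. \<exists>v\<in>c'. zz_eq \<C> W A C (u @ v) w}, C))\<rparr>"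

definition loc_functor :: "('o, 'm) category \<Rightarrow> 'm set \<Rightarrow> ('o, 'm, 'o, ('o, 'm) loc_arr) cfunctor" where
  "loc_functor \<C> W =
     \<lparr>onOb = (\<lambda>A. A), onArr = (\<lambda>f. zz_class \<C> W (Src \<C> f) (Tgt \<C> f) [Fwd f])\<rparr>"

text \<open>The functor \<open>\<C>[W\<^sup>-\<^sup>1] \<rightarrow> \<D>[V\<^sup>-\<^sup>1]\<close> induced by a functor \<open>F : \<C> \<rightarrow> \<D>\<close> with \<open>F(W) \<subseteq> V\<close>.\<close>

definition induced_functor ::
  "('o2, 'm2) category \<Rightarrow> 'm2 set \<Rightarrow> ('o1, 'm1, 'o2, 'm2) cfunctor \<Rightarrow>
   ('o1, ('o1, 'm1) loc_arr, 'o2, ('o2, 'm2) loc_arr) cfunctor" where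
  "induced_functor \<D> V F =
     \<lparr>onOb = onOb F,
      onArr = (\<lambda>(A, c, B). (onOb F A,
        {w. \<exists>u\<in>c. zz_eq \<D> V (onOb F A) (onOb F B) (map (map_zigzag_step (onArr F)) u) w},
        onOb F B))\<rparr>"

text \<open>\<open>L\<close> with \<open>\<epsilon> : L \<circ> Q \<Rightarrow> Q \<circ> F\<close> is the (total) left derived functor of \<open>F : \<C> \<rightarrow> \<D>\<close>: the pair is
  terminal among functors \<open>G : \<C>[W\<^sup>-\<^sup>1] \<rightarrow> \<D>[V\<^sup>-\<^sup>1]\<close> equipped with a transformation
  \<open>G \<circ> Q \<Rightarrow> Q \<circ> F\<close>.\<close>

definition is_left_derived ::
  "('o1, 'm1) category \<Rightarrow> 'm1 set \<Rightarrow> ('o2, 'm2) category \<Rightarrow> 'm2 set \<Rightarrow>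
   ('o1, 'm1, 'o2, 'm2) cfunctor \<Rightarrow>
   ('o1, ('o1, 'm1) loc_arr, 'o2, ('o2, 'm2) loc_arr) cfunctor \<Rightarrow>
   ('o1 \<Rightarrow> ('o2, 'm2) loc_arr) \<Rightarrow> bool" where
  "is_left_derived \<C> W \<D> V F L \<epsilon> \<longleftrightarrow>
     is_functor (localization \<C> W) (localization \<D> V) L \<and>
     nat_trans \<C> (localization \<D> V) (L \<cdot>\<^sub>F loc_functor \<C> W) (loc_functor \<D> V \<cdot>\<^sub>F F) \<epsilon> \<and>
     (\<forall>G \<alpha>.
        is_functor (localization \<C> W) (localization \<D> V) G \<and>
        nat_trans \<C> (localization \<D> V) (G \<cdot>\<^sub>F loc_functor \<C> W) (loc_functor \<D> V \<cdot>\<^sub>F F) \<alpha> \<longrightarrow>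
        (\<exists>!\<tau>. nat_trans (localization \<C> W) (localization \<D> V) G L \<tau> \<and>
              (\<forall>A\<in>Ob \<C>. Comp (localization \<D> V) (\<epsilon> A) (\<tau> A) = \<alpha> A)))"


section \<open>Abelian data on a topological space\<close>

definition sp_le :: "'x topology \<Rightarrow> 'x \<Rightarrow> 'x \<Rightarrow> bool" where
  "sp_le X p q \<longleftrightarrow> p \<in> topspace X \<and> q \<in> topspace X \<and> X closure_of {p} \<subseteq> X closure_of {q}"

text \<open>Abelian groups are commutative groups (written multiplicatively) carried by subsets of a
  universe \<^typ>\<open>'u\<close>. Homomorphisms, and all families indexed by points, are normalised to be
  \<open>undefined\<close> where they are irrelevant.\<close>

definition ab_hom :: "'u monoid \<Rightarrow> 'u monoid \<Rightarrow> ('u \<Rightarrow> 'u) set" where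
  "ab_hom G H = hom G H \<inter> extensional (carrier G)"

record ('x, 'u) data =
  stalk :: "'x \<Rightarrow> 'u monoid"
  rmap :: "'x \<Rightarrow> 'x \<Rightarrow> 'u \<Rightarrow> 'u"

definition abelian_data :: "'x topology \<Rightarrow> ('x, 'u) data \<Rightarrow> bool" where
  "abelian_data X F \<longleftrightarrow>
     stalk F \<in> extensional (topspace X) \<and>
     (\<forall>x y. \<not> sp_le X x y \<longrightarrow> rmap F x y = undefined) \<and>
     (\<forall>x\<in>topspace X. comm_group (stalk F x)) \<and>
     (\<forall>x y. sp_le X x y \<longrightarrow> rmap F x y \<in> ab_hom (stalk F x) (stalk F y)) \<and>
     (\<forall>x\<in>topspace X. \<forall>a\<in>carrier (stalk F x). rmap F x x a = a) \<and>
     (\<forall>x y z. sp_le X x y \<and> sp_le X y z \<longrightarrow>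
        (\<forall>a\<in>carrier (stalk F x). rmap F y z (rmap F x y a) = rmap F x z a))"

definition data_hom ::
  "'x topology \<Rightarrow> ('x, 'u) data \<Rightarrow> ('x, 'u) data \<Rightarrow> ('x \<Rightarrow> 'u \<Rightarrow> 'u) set" where
  "data_hom X F G = {\<phi> \<in> extensional (topspace X).
     (\<forall>x\<in>topspace X. \<phi> x \<in> ab_hom (stalk F x) (stalk G x)) \<and>
     (\<forall>x y. sp_le X x y \<longrightarrow>
        (\<forall>a\<in>carrier (stalk F x). \<phi> y (rmap F x y a) = rmap G x y (\<phi> x a)))}"

definition inv_image_data :: "'x topology \<Rightarrow> ('x \<Rightarrow> 'y) \<Rightarrow> ('y, 'u) data \<Rightarrow> ('x, 'u) data" where
  "inv_image_data X f G =
     \<lparr>stalk = (\<lambda>x\<in>topspace X. stalk G (f x)),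
      rmap = (\<lambda>x x'. if sp_le X x x' then rmap G (f x) (f x') else undefined)\<rparr>"

abbreviation restrict_data :: "'x topology \<Rightarrow> 'x set \<Rightarrow> ('x, 'u) data \<Rightarrow> ('x, 'u) data" where
  "restrict_data X S F \<equiv> inv_image_data (subtopology X S) (\<lambda>x. x) F"


subsection \<open>Colimits and \<open>f\<^sub>!\<close>\<close>

definition is_cocone ::
  "'x topology \<Rightarrow> ('x, 'u) data \<Rightarrow> 'u monoid \<Rightarrow> ('x \<Rightarrow> 'u \<Rightarrow> 'u) \<Rightarrow> bool" where
  "is_cocone X F T \<kappa> \<longleftrightarrow>
     comm_group T \<and> \<kappa> \<in> extensional (topspace X) \<and>
     (\<forall>x\<in>topspace X. \<kappa> x \<in> ab_hom (stalk F x) T) \<and>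
     (\<forall>x y. sp_le X x y \<longrightarrow> (\<forall>a\<in>carrier (stalk F x). \<kappa> y (rmap F x y a) = \<kappa> x a))"

definition factors_through ::
  "'x topology \<Rightarrow> ('x, 'u) data \<Rightarrow> 'u monoid \<Rightarrow> ('x \<Rightarrow> 'u \<Rightarrow> 'u) \<Rightarrow> 'u monoid \<Rightarrow>
   ('x \<Rightarrow> 'u \<Rightarrow> 'u) \<Rightarrow> ('u \<Rightarrow> 'u) \<Rightarrow> bool" where
  "factors_through X F L \<iota> T \<kappa> h \<longleftrightarrow>
     h \<in> ab_hom L T \<and> (\<forall>x\<in>topspace X. \<forall>a\<in>carrier (stalk F x). h (\<iota> x a) = \<kappa> x a)"

definition is_colimit ::
  "'x topology \<Rightarrow> ('x, 'u) data \<Rightarrow> 'u monoid \<times> ('x \<Rightarrow> 'u \<Rightarrow> 'u) \<Rightarrow> bool" where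
  "is_colimit X F = (\<lambda>(L, \<iota>). is_cocone X F L \<iota> \<and>
     (\<forall>T \<kappa>. is_cocone X F T \<kappa> \<longrightarrow> (\<exists>!h. factors_through X F L \<iota> T \<kappa> h)))"

text \<open>A chosen colimit of \<open>F\<close> over the whole space \<open>X\<close>. On finite \<open>X\<close> it exists for infinite
  \<^typ>\<open>'u\<close>, being a quotient of the direct sum of the stalks.\<close>

definition colim :: "'x topology \<Rightarrow> ('x, 'u) data \<Rightarrow> 'u monoid \<times> ('x \<Rightarrow> 'u \<Rightarrow> 'u)" where
  "colim X F = (SOME c. is_colimit X F c)"

definition colim_desc ::
  "'x topology \<Rightarrow> ('x, 'u) data \<Rightarrow> 'u monoid \<Rightarrow> ('x \<Rightarrow> 'u \<Rightarrow> 'u) \<Rightarrow> 'u \<Rightarrow> 'u" where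
  "colim_desc X F T \<kappa> = (THE h. factors_through X F (fst (colim X F)) (snd (colim X F)) T \<kappa> h)"

definition cl_fibre :: "'x topology \<Rightarrow> 'y topology \<Rightarrow> ('x \<Rightarrow> 'y) \<Rightarrow> 'y \<Rightarrow> 'x set" where
  "cl_fibre X Y f y = {x \<in> topspace X. f x \<in> Y closure_of {y}}"

definition fibre_colim ::
  "'x topology \<Rightarrow> 'y topology \<Rightarrow> ('x \<Rightarrow> 'y) \<Rightarrow> ('x, 'u) data \<Rightarrow> 'y \<Rightarrow>
   'u monoid \<times> ('x \<Rightarrow> 'u \<Rightarrow> 'u)" where
  "fibre_colim X Y f F y =
     colim (subtopology X (cl_fibre X Y f y)) (restrict_data X (cl_fibre X Y f y) F)"

definition fibre_desc ::
  "'x topology \<Rightarrow> 'y topology \<Rightarrow> ('x \<Rightarrow> 'y) \<Rightarrow> ('x, 'u) data \<Rightarrow> 'y \<Rightarrow>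
   'u monoid \<Rightarrow> ('x \<Rightarrow> 'u \<Rightarrow> 'u) \<Rightarrow> 'u \<Rightarrow> 'u" where
  "fibre_desc X Y f F y T \<kappa> =
     colim_desc (subtopology X (cl_fibre X Y f y)) (restrict_data X (cl_fibre X Y f y) F)
       T (restrict \<kappa> (cl_fibre X Y f y))"

definition shriek_data ::
  "'x topology \<Rightarrow> 'y topology \<Rightarrow> ('x \<Rightarrow> 'y) \<Rightarrow> ('x, 'u) data \<Rightarrow> ('y, 'u) data" where
  "shriek_data X Y f F =
     \<lparr>stalk = (\<lambda>y\<in>topspace Y. fst (fibre_colim X Y f F y)),
      rmap = (\<lambda>y y'. if sp_le Y y y'
        then fibre_desc X Y f F y (fst (fibre_colim X Y f F y')) (snd (fibre_colim X Y f F y'))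
        else undefined)\<rparr>"

definition shriek_map ::
  "'x topology \<Rightarrow> 'y topology \<Rightarrow> ('x \<Rightarrow> 'y) \<Rightarrow> ('x, 'u) data \<Rightarrow> ('x, 'u) data \<Rightarrow>
   ('x \<Rightarrow> 'u \<Rightarrow> 'u) \<Rightarrow> 'y \<Rightarrow> 'u \<Rightarrow> 'u" where
  "shriek_map X Y f F G \<phi> =
     (\<lambda>y\<in>topspace Y. fibre_desc X Y f F y (fst (fibre_colim X Y f G y))
        (\<lambda>x. compose (carrier (stalk F x)) (snd (fibre_colim X Y f G y) x) (\<phi> x)))"


section \<open>Complexes and the derived category\<close>

record ('x, 'u) dcomplex =
  deg :: "int \<Rightarrow> ('x, 'u) data"
  diff :: "int \<Rightarrow> 'x \<Rightarrow> 'u \<Rightarrow> 'u"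

definition is_complex :: "'x topology \<Rightarrow> ('x, 'u) dcomplex \<Rightarrow> bool" where
  "is_complex X A \<longleftrightarrow>
     (\<forall>n. abelian_data X (deg A n) \<and> diff A n \<in> data_hom X (deg A n) (deg A (n + 1))) \<and>
     (\<forall>n. \<forall>x\<in>topspace X. \<forall>a\<in>carrier (stalk (deg A n) x).
        diff A (n + 1) x (diff A n x a) = \<one>\<^bsub>stalk (deg A (n + 2)) x\<^esub>)"

definition chain_map ::
  "'x topology \<Rightarrow> ('x, 'u) dcomplex \<Rightarrow> ('x, 'u) dcomplex \<Rightarrow> (int \<Rightarrow> 'x \<Rightarrow> 'u \<Rightarrow> 'u) \<Rightarrow> bool" where
  "chain_map X A B \<phi> \<longleftrightarrow>
     (\<forall>n. \<phi> n \<in> data_hom X (deg A n) (deg B n)) \<and>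
     (\<forall>n. \<forall>x\<in>topspace X. \<forall>a\<in>carrier (stalk (deg A n) x).
        \<phi> (n + 1) x (diff A n x a) = diff B n x (\<phi> n x a))"

type_synonym ('x, 'u) ch_arr =
  "('x, 'u) dcomplex \<times> (int \<Rightarrow> 'x \<Rightarrow> 'u \<Rightarrow> 'u) \<times> ('x, 'u) dcomplex"

definition Ch :: "'x topology \<Rightarrow> (('x, 'u) dcomplex, ('x, 'u) ch_arr) category" where
  "Ch X =
     \<lparr>Ob = {A. is_complex X A},
      Arr = {(A, \<phi>, B). is_complex X A \<and> is_complex X B \<and> chain_map X A B \<phi>},
      Src = (\<lambda>(A, \<phi>, B). A),
      Tgt = (\<lambda>(A, \<phi>, B). B),
      Idn = (\<lambda>A. (A, (\<lambda>n. \<lambda>x\<in>topspace X. \<lambda>a\<in>carrier (stalk (deg A n) x). a), A)),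
      Comp = (\<lambda>(B', \<psi>, C) (A, \<phi>, B).
        (A, (\<lambda>n. \<lambda>x\<in>topspace X. compose (carrier (stalk (deg A n) x)) (\<psi> n x) (\<phi> n x)), C))\<rparr>"

text \<open>Kernels, images and cokernels of abelian data are computed pointwise, hence so is cohomology.\<close>

definition coboundaries :: "('x, 'u) dcomplex \<Rightarrow> int \<Rightarrow> 'x \<Rightarrow> 'u set" where
  "coboundaries A n x = diff A (n - 1) x ` carrier (stalk (deg A (n - 1)) x)"

definition cohomology :: "('x, 'u) dcomplex \<Rightarrow> int \<Rightarrow> 'x \<Rightarrow> 'u set monoid" where
  "cohomology A n x =
     (stalk (deg A n) x)
       \<lparr>carrier := kernel (stalk (deg A n) x) (stalk (deg A (n + 1)) x) (diff A n x)\<rparr>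
     Mod coboundaries A n x"

definition cohomology_map :: "('x, 'u) ch_arr \<Rightarrow> int \<Rightarrow> 'x \<Rightarrow> 'u set \<Rightarrow> 'u set" where
  "cohomology_map = (\<lambda>(A, \<phi>, B) n x c. coboundaries B n x <#>\<^bsub>stalk (deg B n) x\<^esub> (\<phi> n x ` c))"

definition quasi_isos :: "'x topology \<Rightarrow> ('x, 'u) ch_arr set" where
  "quasi_isos X = {s \<in> Arr (Ch X). \<forall>n. \<forall>x\<in>topspace X.
     cohomology_map s n x \<in> iso (cohomology (Src (Ch X) s) n x) (cohomology (Tgt (Ch X) s) n x)}"

type_synonym ('x, 'u) d_arr = "(('x, 'u) dcomplex, ('x, 'u) ch_arr) loc_arr"

type_synonym ('x, 'y, 'u) d_functor =
  "(('x, 'u) dcomplex, ('x, 'u) d_arr, ('y, 'u) dcomplex, ('y, 'u) d_arr) cfunctor"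

definition Der :: "'x topology \<Rightarrow> (('x, 'u) dcomplex, ('x, 'u) d_arr) category" where
  "Der X = localization (Ch X) (quasi_isos X)"

definition inv_image_complex ::
  "'x topology \<Rightarrow> ('x \<Rightarrow> 'y) \<Rightarrow> ('y, 'u) dcomplex \<Rightarrow> ('x, 'u) dcomplex" where
  "inv_image_complex X f A =
     \<lparr>deg = (\<lambda>n. inv_image_data X f (deg A n)), diff = (\<lambda>n. \<lambda>x\<in>topspace X. diff A n (f x))\<rparr>"

definition inv_image_Ch ::
  "'x topology \<Rightarrow> ('x \<Rightarrow> 'y) \<Rightarrow>
   (('y, 'u) dcomplex, ('y, 'u) ch_arr, ('x, 'u) dcomplex, ('x, 'u) ch_arr) cfunctor" where
  "inv_image_Ch X f =
     \<lparr>onOb = inv_image_complex X f,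
      onArr = (\<lambda>(A, \<phi>, B).
        (inv_image_complex X f A, (\<lambda>n. \<lambda>x\<in>topspace X. \<phi> n (f x)), inv_image_complex X f B))\<rparr>"

text \<open>\<open>f\<^sup>-\<^sup>1\<close> is exact, so on derived categories it is simply the functor it induces.
  \<open>restrict_D X S\<close> is \<open>K \<mapsto> K\<^bsub>|S\<^esub>\<close>.\<close>

definition inv_image_D :: "'x topology \<Rightarrow> ('x \<Rightarrow> 'y) \<Rightarrow> ('y, 'x, 'u) d_functor" where
  "inv_image_D X f = induced_functor (Ch X) (quasi_isos X) (inv_image_Ch X f)"

abbreviation restrict_Ch ::
  "'x topology \<Rightarrow> 'x set \<Rightarrow>
   (('x, 'u) dcomplex, ('x, 'u) ch_arr, ('x, 'u) dcomplex, ('x, 'u) ch_arr) cfunctor" where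
  "restrict_Ch X S \<equiv> inv_image_Ch (subtopology X S) (\<lambda>x. x)"

abbreviation restrict_D :: "'x topology \<Rightarrow> 'x set \<Rightarrow> ('x, 'x, 'u) d_functor" where
  "restrict_D X S \<equiv> inv_image_D (subtopology X S) (\<lambda>x. x)"

definition shriek_complex ::
  "'x topology \<Rightarrow> 'y topology \<Rightarrow> ('x \<Rightarrow> 'y) \<Rightarrow> ('x, 'u) dcomplex \<Rightarrow> ('y, 'u) dcomplex" where
  "shriek_complex X Y f A =
     \<lparr>deg = (\<lambda>n. shriek_data X Y f (deg A n)),
      diff = (\<lambda>n. shriek_map X Y f (deg A n) (deg A (n + 1)) (diff A n))\<rparr>"

definition shriek_Ch ::
  "'x topology \<Rightarrow> 'y topology \<Rightarrow> ('x \<Rightarrow> 'y) \<Rightarrow>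
   (('x, 'u) dcomplex, ('x, 'u) ch_arr, ('y, 'u) dcomplex, ('y, 'u) ch_arr) cfunctor" where
  "shriek_Ch X Y f =
     \<lparr>onOb = shriek_complex X Y f,
      onArr = (\<lambda>(A, \<phi>, B). (shriek_complex X Y f A,
        (\<lambda>n. shriek_map X Y f (deg A n) (deg B n) (\<phi> n)), shriek_complex X Y f B))\<rparr>"

definition derived_shriek ::
  "'x topology \<Rightarrow> 'y topology \<Rightarrow> ('x \<Rightarrow> 'y) \<Rightarrow> ('x, 'y, 'u) d_functor \<Rightarrow>
   (('x, 'u) dcomplex \<Rightarrow> ('y, 'u) d_arr) \<Rightarrow> bool" where
  "derived_shriek X Y f L \<epsilon> \<longleftrightarrow>
     is_left_derived (Ch X) (quasi_isos X) (Ch Y) (quasi_isos Y) (shriek_Ch X Y f) L \<epsilon>"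

text \<open>Base change along a closed \<open>C \<subseteq> Y\<close>: since \<open>C\<close> contains the closure of each of its points,
  \<open>(f\<^sub>! F)\<^bsub>|C\<^esub>\<close> and \<open>(f\<^sub>C)\<^sub>! (F\<^bsub>|f\<^sup>-\<^sup>1 C\<^esub>)\<close> are the same abelian data.\<close>

lemma sp_le_subtopology:
  assumes "S \<subseteq> topspace X"
  shows "sp_le (subtopology X S) p q \<longleftrightarrow> p \<in> S \<and> q \<in> S \<and> sp_le X p q"
proof (cases "p \<in> S \<and> q \<in> S")
  case True
  then have T: "p \<in> S" "q \<in> S" "p \<in> topspace X" "q \<in> topspace X" using assms by auto
  have "subtopology X S closure_of {p} = S \<inter> X closure_of {p}"
    "subtopology X S closure_of {q} = S \<inter> X closure_of {q}"
    using T by (simp_all add: closure_of_subtopology)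
  moreover have "p \<in> X closure_of {p}"
    using T closure_of_subset[of "{p}" X] by simp
  moreover have "X closure_of {p} \<subseteq> X closure_of {q} \<longleftrightarrow> p \<in> X closure_of {q}"
    using \<open>p \<in> X closure_of {p}\<close> by (meson closedin_closure_of closure_of_minimal empty_subsetI
        insert_subset subsetD)
  ultimately show ?thesis using T assms unfolding sp_le_def
    by (auto simp: topspace_subtopology)
next
  case False
  then show ?thesis by (auto simp: sp_le_def topspace_subtopology)
qed

lemma restrict_restrict_data:
  assumes "S \<subseteq> U" "U \<subseteq> topspace X"
  shows "restrict_data (subtopology X U) S (restrict_data X U F) = restrict_data X S F"
proof -
  have "subtopology (subtopology X U) S = subtopology X S"
    using assms(1) by (simp add: subtopology_subtopology Int_absorb1)
  moreover have "S \<subseteq> topspace X" using assms by blast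
  ultimately show ?thesis
    using assms by (auto simp: inv_image_data_def sp_le_subtopology fun_eq_iff subset_iff)
qed

lemma shriek_restrict:
  assumes C: "closedin Y C" and U_def: "U = {x \<in> topspace X. f x \<in> C}"
  shows shriek_data_restrict: "restrict_data Y C (shriek_data X Y f F)
      = shriek_data (subtopology X U) (subtopology Y C) f (restrict_data X U F)"
    and shriek_map_restrict: "restrict (shriek_map X Y f F G \<phi>) C
      = shriek_map (subtopology X U) (subtopology Y C) f (restrict_data X U F) (restrict_data X U G)
          (restrict \<phi> U)"
proof -
  have CY: "C \<subseteq> topspace Y" using C by (rule closedin_subset)
  have UX: "U \<subseteq> topspace X" by (auto simp: U_def)
  have fib: "cl_fibre (subtopology X U) (subtopology Y C) f y = cl_fibre X Y f y"
    and fibU: "cl_fibre X Y f y \<subseteq> U" if "y \<in> C" for y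
  proof -
    have "Y closure_of {y} \<subseteq> C" using that C by (simp add: closure_of_minimal)
    moreover have "subtopology Y C closure_of {y} = C \<inter> Y closure_of {y}"
      using that by (simp add: closure_of_subtopology)
    ultimately show "cl_fibre (subtopology X U) (subtopology Y C) f y = cl_fibre X Y f y"
      "cl_fibre X Y f y \<subseteq> U"
      by (auto simp: cl_fibre_def U_def)
  qed
  have sub: "subtopology (subtopology X U) (cl_fibre X Y f y) = subtopology X (cl_fibre X Y f y)"
    if "y \<in> C" for y
    using fibU[OF that] by (simp add: subtopology_subtopology Int_absorb1)
  have rr: "restrict_data X (cl_fibre X Y f y) (restrict_data X U F)
      = restrict_data X (cl_fibre X Y f y) F" if "y \<in> C" for y F
    using restrict_restrict_data[OF fibU[OF that] UX] unfolding sub[OF that] .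
  have col: "fibre_colim (subtopology X U) (subtopology Y C) f (restrict_data X U F) y
           = fibre_colim X Y f F y" if "y \<in> C" for y F
    unfolding fibre_colim_def fib[OF that] rr[OF that] sub[OF that] ..
  have desc: "fibre_desc (subtopology X U) (subtopology Y C) f (restrict_data X U F) y
            = fibre_desc X Y f F y" if "y \<in> C" for y F
    unfolding fibre_desc_def fib[OF that] rr[OF that] sub[OF that] ..
  show "restrict_data Y C (shriek_data X Y f F)
      = shriek_data (subtopology X U) (subtopology Y C) f (restrict_data X U F)"
    using CY by (auto simp: inv_image_data_def[of "subtopology Y C"] shriek_data_def sp_le_subtopology col desc
        fun_eq_iff restrict_def subset_iff)
  have loc: "fibre_desc X Y f F y T \<kappa> = fibre_desc X Y f F y T \<kappa>'"
    if "y \<in> C" "\<And>x. x \<in> U \<Longrightarrow> \<kappa> x = \<kappa>' x" for y T \<kappa> \<kappa>'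
  proof -
    have "restrict \<kappa> (cl_fibre X Y f y) = restrict \<kappa>' (cl_fibre X Y f y)"
      using that fibU[OF that(1)] by (auto simp: restrict_def fun_eq_iff)
    then show ?thesis by (simp add: fibre_desc_def)
  qed
  show "restrict (shriek_map X Y f F G \<phi>) C
      = shriek_map (subtopology X U) (subtopology Y C) f (restrict_data X U F) (restrict_data X U G)
          (restrict \<phi> U)"
  proof
    fix y
    show "restrict (shriek_map X Y f F G \<phi>) C y
      = shriek_map (subtopology X U) (subtopology Y C) f (restrict_data X U F) (restrict_data X U G)
          (restrict \<phi> U) y"
    proof (cases "y \<in> C")
      case True
      have "stalk (restrict_data X U F) x = stalk F x" if "x \<in> U" for x
        using that UX by (auto simp: inv_image_data_def)
      then show ?thesis
        using True CY by (auto simp: shriek_map_def col desc intro!: loc)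
    next
      case False
      then show ?thesis by (simp add: shriek_map_def)
    qed
  qed
qed

lemma shriek_Ch_restrict:
  assumes "closedin Y C" and "U = {x \<in> topspace X. f x \<in> C}"
  shows "onOb (restrict_Ch Y C \<cdot>\<^sub>F shriek_Ch X Y f) A
       = onOb (shriek_Ch (subtopology X U) (subtopology Y C) f \<cdot>\<^sub>F restrict_Ch X U) A"
proof -
  have "topspace Y \<inter> C = C" "topspace X \<inter> U = U" using assms closedin_subset by auto
  then show ?thesis
    by (simp add: compF_def inv_image_Ch_def shriek_Ch_def inv_image_complex_def
        shriek_complex_def shriek_data_restrict[OF assms] shriek_map_restrict[OF assms])
qed

text \<open>\<open>(L, \<epsilon>)\<close> and \<open>(LC, \<epsilon>C)\<close> are the derived functors of \<open>f\<^sub>!\<close> and \<open>(f\<^sub>C)\<^sub>!\<close>. The base change morphism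
  \<open>\<beta>\<close> from \<open>(L F)\<^bsub>|C\<^esub>\<close> to \<open>LC (F\<^bsub>|f\<^sup>-\<^sup>1 C\<^esub>)\<close> is the one lying over the identification
  \<open>shriek_Ch_restrict\<close> of the underived functors.\<close>

definition is_base_change ::
  "'x topology \<Rightarrow> 'y topology \<Rightarrow> 'x set \<Rightarrow> 'y set \<Rightarrow>
   ('x, 'y, 'u) d_functor \<Rightarrow> (('x, 'u) dcomplex \<Rightarrow> ('y, 'u) d_arr) \<Rightarrow>
   ('x, 'y, 'u) d_functor \<Rightarrow> (('x, 'u) dcomplex \<Rightarrow> ('y, 'u) d_arr) \<Rightarrow>
   (('x, 'u) dcomplex \<Rightarrow> ('y, 'u) d_arr) \<Rightarrow> bool" where
  "is_base_change X Y U C L \<epsilon> LC \<epsilon>C \<beta> \<longleftrightarrow>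
     nat_trans (Der X) (Der (subtopology Y C))
       (restrict_D Y C \<cdot>\<^sub>F L) (LC \<cdot>\<^sub>F restrict_D X U) \<beta> \<and>
     (\<forall>F\<in>Ob (Ch X).
        Comp (Der (subtopology Y C)) (\<epsilon>C (onOb (restrict_D X U) F)) (\<beta> F)
        = onArr (restrict_D Y C) (\<epsilon> F))"

end

theory Submission
  imports Defs
begin

text \<open>Since \<open>f\<close> is continuous, \<open>U = f\<^sup>-\<^sup>1(C)\<close> is closed, so extension by zero from \<open>U\<close> is an
  exact right adjoint section of restriction to \<open>U\<close>. Both functors descend to the derived categories,
  where restriction becomes a reflector; precomposition with a reflector preserves right Kan extensions,
  so \<open>LC\<close> composed with restriction to \<open>U\<close> is a left derived functor of \<open>(f\<^sub>C)\<^sub>!\<close> composed with that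
  restriction. Its universal property yields \<open>\<beta>\<close>, and \<open>m\<close> is the mate of \<open>\<beta>\<close> under the two
  adjunctions.\<close>

section \<open>Elementary category theory, up to mates under a pair of adjunctions\<close>

section \<open>Categories and functors\<close>

text \<open>The universal property of \<open>LC\<close> speaks only about functors on the derived
  category of \<open>U\<close>, whereas L F restricted to \<open>C\<close> is a functor of F in the
  derived category of \<open>X\<close>. Derived functors are known here through their universal
  property alone, so no resolution can be restricted in order to compare the two. The reflector
  fills this gap: a transformation from a functor G on the derived category of \<open>X\<close> to
  \<open>LC\<close> after restriction is the same as one to \<open>LC\<close> from G after extension
  by zero, by transposing along the unit. The restriction of \<epsilon> to \<open>C\<close> can be
  fed into this because f_! commutes with restriction to a closed set on the nose: the colimit at y
  in \<open>C\<close> runs over the preimage of the closure of y, and that closure stays inside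
  \<open>C\<close>. Terminality yields maps into the derived functor, which is the direction of
  \<beta> that transposition under the two adjunctions requires.\<close>

definition is_precategory :: "('o, 'm) category \<Rightarrow> bool" where
  "is_precategory \<C> \<longleftrightarrow>
     (\<forall>A\<in>Ob \<C>. Idn \<C> A \<in> Hom \<C> A A) \<and>
     (\<forall>A\<in>Ob \<C>. \<forall>B\<in>Ob \<C>. \<forall>C\<in>Ob \<C>. \<forall>f\<in>Hom \<C> A B. \<forall>g\<in>Hom \<C> B C. Comp \<C> g f \<in> Hom \<C> A C)"

definition is_category :: "('o, 'm) category \<Rightarrow> bool" where
  "is_category \<C> \<longleftrightarrow> is_precategory \<C> \<and>
     (\<forall>A\<in>Ob \<C>. \<forall>B\<in>Ob \<C>. \<forall>f\<in>Hom \<C> A B. Comp \<C> f (Idn \<C> A) = f \<and> Comp \<C> (Idn \<C> B) f = f) \<and>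
     (\<forall>A\<in>Ob \<C>. \<forall>B\<in>Ob \<C>. \<forall>C\<in>Ob \<C>. \<forall>D\<in>Ob \<C>.
        \<forall>f\<in>Hom \<C> A B. \<forall>g\<in>Hom \<C> B C. \<forall>h\<in>Hom \<C> C D.
          Comp \<C> h (Comp \<C> g f) = Comp \<C> (Comp \<C> h g) f)"

lemma Idn_in_Hom: "is_precategory \<C> \<Longrightarrow> A \<in> Ob \<C> \<Longrightarrow> Idn \<C> A \<in> Hom \<C> A A"
  by (auto simp: is_precategory_def)

lemma Comp_in_Hom:
  "\<lbrakk>is_precategory \<C>; A \<in> Ob \<C>; B \<in> Ob \<C>; C \<in> Ob \<C>; f \<in> Hom \<C> A B; g \<in> Hom \<C> B C\<rbrakk>
   \<Longrightarrow> Comp \<C> g f \<in> Hom \<C> A C"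
  by (auto simp: is_precategory_def)

lemma is_category_imp_precategory: "is_category \<C> \<Longrightarrow> is_precategory \<C>"
  by (simp add: is_category_def)

lemma Comp_Idn:
  assumes "is_category \<C>" "A \<in> Ob \<C>" "B \<in> Ob \<C>" "f \<in> Hom \<C> A B"
  shows Comp_Idn_right: "Comp \<C> f (Idn \<C> A) = f" and Comp_Idn_left: "Comp \<C> (Idn \<C> B) f = f"
  using assms by (auto simp: is_category_def)

lemma Comp_assoc:
  "\<lbrakk>is_category \<C>; A \<in> Ob \<C>; B \<in> Ob \<C>; C \<in> Ob \<C>; D \<in> Ob \<C>;
    f \<in> Hom \<C> A B; g \<in> Hom \<C> B C; h \<in> Hom \<C> C D\<rbrakk>
   \<Longrightarrow> Comp \<C> (Comp \<C> h g) f = Comp \<C> h (Comp \<C> g f)"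
  by (simp add: is_category_def)

lemma functor_Ob: "is_functor \<C> \<D> F \<Longrightarrow> A \<in> Ob \<C> \<Longrightarrow> onOb F A \<in> Ob \<D>"
  by (simp add: is_functor_def)

lemma functor_Idn: "is_functor \<C> \<D> F \<Longrightarrow> A \<in> Ob \<C> \<Longrightarrow> onArr F (Idn \<C> A) = Idn \<D> (onOb F A)"
  by (simp add: is_functor_def)

lemma functor_Hom:
  "\<lbrakk>is_functor \<C> \<D> F; A \<in> Ob \<C>; B \<in> Ob \<C>; f \<in> Hom \<C> A B\<rbrakk>
   \<Longrightarrow> onArr F f \<in> Hom \<D> (onOb F A) (onOb F B)"
  by (simp add: is_functor_def)

lemma functor_Comp:
  "\<lbrakk>is_functor \<C> \<D> F; A \<in> Ob \<C>; B \<in> Ob \<C>; C \<in> Ob \<C>; f \<in> Hom \<C> A B; g \<in> Hom \<C> B C\<rbrakk>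
   \<Longrightarrow> onArr F (Comp \<C> g f) = Comp \<D> (onArr F g) (onArr F f)"
  by (simp add: is_functor_def)

lemma compF_simps [simp]:
  "onOb (G \<cdot>\<^sub>F F) A = onOb G (onOb F A)"
  "onArr (G \<cdot>\<^sub>F F) f = onArr G (onArr F f)"
  by (simp_all add: compF_def)

lemma idF_simps [simp]: "onOb idF A = A" "onArr idF f = f"
  by (simp_all add: idF_def)

lemma is_functor_compF:
  assumes "is_functor \<C> \<D> F" "is_functor \<D> \<E> G"
  shows "is_functor \<C> \<E> (G \<cdot>\<^sub>F F)"
  unfolding is_functor_def
proof (intro conjI ballI)
  fix A B C f g assume *: "A \<in> Ob \<C>" "B \<in> Ob \<C>" "C \<in> Ob \<C>" "f \<in> Hom \<C> A B" "g \<in> Hom \<C> B C"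
  then show "onArr (G \<cdot>\<^sub>F F) (Comp \<C> g f) = Comp \<E> (onArr (G \<cdot>\<^sub>F F) g) (onArr (G \<cdot>\<^sub>F F) f)"
    using functor_Comp[OF assms(2) _ _ _ functor_Hom[OF assms(1) *(1,2,4)] functor_Hom[OF assms(1) *(2,3,5)]]
    by (simp add: functor_Comp[OF assms(1) *] functor_Ob[OF assms(1)])
qed (use assms in \<open>simp_all add: functor_Ob functor_Idn functor_Hom\<close>)

lemma nat_trans_Hom:
  "nat_trans \<C> \<D> F G \<tau> \<Longrightarrow> A \<in> Ob \<C> \<Longrightarrow> \<tau> A \<in> Hom \<D> (onOb F A) (onOb G A)"
  by (simp add: nat_trans_def)

lemma nat_trans_natural:
  "\<lbrakk>nat_trans \<C> \<D> F G \<tau>; A \<in> Ob \<C>; B \<in> Ob \<C>; f \<in> Hom \<C> A B\<rbrakk>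
   \<Longrightarrow> Comp \<D> (\<tau> B) (onArr F f) = Comp \<D> (onArr G f) (\<tau> A)"
  by (simp add: nat_trans_def)

lemma nat_trans_ext:
  assumes "nat_trans \<C> \<D> F G \<sigma>" "nat_trans \<C> \<D> F G \<tau>" "\<And>A. A \<in> Ob \<C> \<Longrightarrow> \<sigma> A = \<tau> A"
  shows "\<sigma> = \<tau>"
  using assms by (auto simp: nat_trans_def intro: extensionalityI)

lemma nat_transI:
  assumes "\<tau> \<in> extensional (Ob \<C>)"
    and "\<And>A. A \<in> Ob \<C> \<Longrightarrow> \<tau> A \<in> Hom \<D> (onOb F A) (onOb G A)"
    and "\<And>A B f. \<lbrakk>A \<in> Ob \<C>; B \<in> Ob \<C>; f \<in> Hom \<C> A B\<rbrakk>
      \<Longrightarrow> Comp \<D> (\<tau> B) (onArr F f) = Comp \<D> (onArr G f) (\<tau> A)"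
  shows "nat_trans \<C> \<D> F G \<tau>"
  using assms by (simp add: nat_trans_def)

lemma left_adjoint_unique:
  assumes "is_left_adjoint \<C> \<D> R S \<eta>" "K \<in> Ob \<D>" "F \<in> Ob \<C>" "u \<in> Hom \<D> K (onOb R F)"
  shows "\<exists>!v. v \<in> Hom \<C> (onOb S K) F \<and> Comp \<D> (onArr R v) (\<eta> K) = u"
  using assms by (simp add: is_left_adjoint_def)

text \<open>Transposition under the second adjunction turns the mate equation at K into a condition
  with exactly one solution, so m is forced pointwise. What remains is naturality, and two arrows
  out of \<open>S' (P K)\<close> agree as soon as their transposes do.\<close>

lemma mate_exists_unique:
  assumes cats: "is_category \<D>'" "is_category \<C>'"
    and adj: "is_left_adjoint \<C> \<D> R S \<eta>" and adj': "is_left_adjoint \<C>' \<D>' R' S' \<eta>'"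
    and p: "is_functor \<D> \<D>' P" and q: "is_functor \<C> \<C>' Q"
    and \<beta>: "nat_trans \<C> \<D>' (P \<cdot>\<^sub>F R) (R' \<cdot>\<^sub>F Q) \<beta>"
  shows "\<exists>!m. nat_trans \<D> \<C>' (S' \<cdot>\<^sub>F P) (Q \<cdot>\<^sub>F S) m \<and>
    (\<forall>K\<in>Ob \<D>. Comp \<D>' (onArr R' (m K)) (\<eta>' (onOb P K))
       = Comp \<D>' (\<beta> (onOb S K)) (onArr P (\<eta> K)))"
proof -
  have fR: "is_functor \<C> \<D> R" and fS: "is_functor \<D> \<C> S" and n: "nat_trans \<D> \<D> idF (R \<cdot>\<^sub>F S) \<eta>"
    using adj by (simp_all add: is_left_adjoint_def)
  have fR': "is_functor \<C>' \<D>' R'" and fS': "is_functor \<D>' \<C>' S'"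
    and n': "nat_trans \<D>' \<D>' idF (R' \<cdot>\<^sub>F S') \<eta>'"
    using adj' by (simp_all add: is_left_adjoint_def)
  note pre = cats[THEN is_category_imp_precategory]
  note obs = functor_Ob[OF fR] functor_Ob[OF fS] functor_Ob[OF fR'] functor_Ob[OF fS']
    functor_Ob[OF p] functor_Ob[OF q]
  have \<eta>: "\<eta> K \<in> Hom \<D> K (onOb R (onOb S K))" if "K \<in> Ob \<D>" for K
    using nat_trans_Hom[OF n that] by simp
  have \<eta>': "\<eta>' K \<in> Hom \<D>' K (onOb R' (onOb S' K))" if "K \<in> Ob \<D>'" for K
    using nat_trans_Hom[OF n' that] by simp
  have p\<eta>: "onArr P (\<eta> K) \<in> Hom \<D>' (onOb P K) (onOb P (onOb R (onOb S K)))" if "K \<in> Ob \<D>" for K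
    using that by (intro functor_Hom[OF p] \<eta> obs)
  have \<beta>H: "\<beta> A \<in> Hom \<D>' (onOb P (onOb R A)) (onOb R' (onOb Q A))" if "A \<in> Ob \<C>" for A
    using nat_trans_Hom[OF \<beta> that] by simp
  \<comment> \<open>\<open>w K\<close> is the prescribed transpose of \<open>m K\<close>: apply P to
    the unit at K, then cross over to the primed side by \<beta>.\<close>
  define w where "w K = Comp \<D>' (\<beta> (onOb S K)) (onArr P (\<eta> K))" for K
  have w: "w K \<in> Hom \<D>' (onOb P K) (onOb R' (onOb Q (onOb S K)))" if "K \<in> Ob \<D>" for K
    unfolding w_def using that by (intro Comp_in_Hom[OF pre(1) _ _ _ p\<eta> \<beta>H] obs)
  have ex1: "\<exists>!v. v \<in> Hom \<C>' (onOb S' (onOb P K)) (onOb Q (onOb S K)) \<and>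
      Comp \<D>' (onArr R' v) (\<eta>' (onOb P K)) = w K" if "K \<in> Ob \<D>" for K
    using that by (intro left_adjoint_unique[OF adj'] obs w)
  define m where "m = (\<lambda>K\<in>Ob \<D>. THE v. v \<in> Hom \<C>' (onOb S' (onOb P K)) (onOb Q (onOb S K)) \<and>
      Comp \<D>' (onArr R' v) (\<eta>' (onOb P K)) = w K)"
  have mH: "m K \<in> Hom \<C>' (onOb S' (onOb P K)) (onOb Q (onOb S K))"
    and mw: "Comp \<D>' (onArr R' (m K)) (\<eta>' (onOb P K)) = w K" if "K \<in> Ob \<D>" for K
    using theI'[OF ex1[OF that]] that by (simp_all add: m_def)
  have "nat_trans \<D> \<C>' (S' \<cdot>\<^sub>F P) (Q \<cdot>\<^sub>F S) m"
  proof (rule nat_transI)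
    show "m \<in> extensional (Ob \<D>)" by (simp add: m_def)
  next
    fix K assume "K \<in> Ob \<D>"
    then show "m K \<in> Hom \<C>' (onOb (S' \<cdot>\<^sub>F P) K) (onOb (Q \<cdot>\<^sub>F S) K)" using mH by simp
  next
    fix K K' k assume K: "K \<in> Ob \<D>" and K': "K' \<in> Ob \<D>" and k: "k \<in> Hom \<D> K K'"
    note KO = K K' obs
    have Pk: "onArr P k \<in> Hom \<D>' (onOb P K) (onOb P K')"
      by (rule functor_Hom[OF p K K' k])
    have Sk: "onArr S k \<in> Hom \<C> (onOb S K) (onOb S K')"
      by (rule functor_Hom[OF fS K K' k])
    have RSk: "onArr R (onArr S k) \<in> Hom \<D> (onOb R (onOb S K)) (onOb R (onOb S K'))"
      by (rule functor_Hom[OF fR _ _ Sk]) (intro KO)+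
    have PRSk: "onArr P (onArr R (onArr S k))
        \<in> Hom \<D>' (onOb P (onOb R (onOb S K))) (onOb P (onOb R (onOb S K')))"
      by (rule functor_Hom[OF p _ _ RSk]) (intro KO)+
    have QSk: "onArr Q (onArr S k) \<in> Hom \<C>' (onOb Q (onOb S K)) (onOb Q (onOb S K'))"
      by (rule functor_Hom[OF q _ _ Sk]) (intro KO)+
    have R'QSk: "onArr R' (onArr Q (onArr S k))
        \<in> Hom \<D>' (onOb R' (onOb Q (onOb S K))) (onOb R' (onOb Q (onOb S K')))"
      by (rule functor_Hom[OF fR' _ _ QSk]) (intro KO)+
    have S'Pk: "onArr S' (onArr P k) \<in> Hom \<C>' (onOb S' (onOb P K)) (onOb S' (onOb P K'))"
      by (rule functor_Hom[OF fS' _ _ Pk]) (intro KO)+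
    have R'S'Pk: "onArr R' (onArr S' (onArr P k))
        \<in> Hom \<D>' (onOb R' (onOb S' (onOb P K))) (onOb R' (onOb S' (onOb P K')))"
      by (rule functor_Hom[OF fR' _ _ S'Pk]) (intro KO)+
    have R'm: "onArr R' (m K) \<in> Hom \<D>' (onOb R' (onOb S' (onOb P K))) (onOb R' (onOb Q (onOb S K)))"
      if "K \<in> Ob \<D>" for K
      by (rule functor_Hom[OF fR' _ _ mH]) (intro that KO)+
    \<comment> \<open>\<open>?l\<close> and \<open>?r\<close> are the two sides of the naturality
      square of m at k. Both are shown to have the transpose \<open>?u\<close>: the left one by
      naturality of \<open>\<eta>'\<close>, the right one by naturality of \<beta> and of
      \<eta>.\<close>
    let ?l = "Comp \<C>' (m K') (onArr S' (onArr P k))"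
    let ?r = "Comp \<C>' (onArr Q (onArr S k)) (m K)"
    let ?u = "Comp \<D>' (w K') (onArr P k)"
    have lH: "?l \<in> Hom \<C>' (onOb S' (onOb P K)) (onOb Q (onOb S K'))"
      by (rule Comp_in_Hom[OF pre(2) _ _ _ S'Pk mH]) (intro KO)+
    have rH: "?r \<in> Hom \<C>' (onOb S' (onOb P K)) (onOb Q (onOb S K'))"
      by (rule Comp_in_Hom[OF pre(2) _ _ _ mH QSk]) (intro KO)+
    have uH: "?u \<in> Hom \<D>' (onOb P K) (onOb R' (onOb Q (onOb S K')))"
      by (rule Comp_in_Hom[OF pre(1) _ _ _ Pk w]) (intro KO)+
    have "Comp \<D>' (onArr R' ?l) (\<eta>' (onOb P K))
        = Comp \<D>' (Comp \<D>' (onArr R' (m K')) (onArr R' (onArr S' (onArr P k)))) (\<eta>' (onOb P K))"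
      by (subst functor_Comp[OF fR' _ _ _ S'Pk mH]) (intro refl KO)+
    also have "\<dots> = Comp \<D>' (onArr R' (m K')) (Comp \<D>' (onArr R' (onArr S' (onArr P k))) (\<eta>' (onOb P K)))"
      by (rule Comp_assoc[OF cats(1) _ _ _ _ \<eta>' R'S'Pk R'm]) (intro KO)+
    also have "\<dots> = Comp \<D>' (onArr R' (m K')) (Comp \<D>' (\<eta>' (onOb P K')) (onArr P k))"
      using nat_trans_natural[OF n' _ _ Pk] KO by simp
    also have "\<dots> = Comp \<D>' (Comp \<D>' (onArr R' (m K')) (\<eta>' (onOb P K'))) (onArr P k)"
      by (rule Comp_assoc[OF cats(1) _ _ _ _ Pk \<eta>' R'm, symmetric]) (intro KO)+
    finally have l: "Comp \<D>' (onArr R' ?l) (\<eta>' (onOb P K)) = ?u"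
      using mw[OF K'] by simp
    have "Comp \<D>' (onArr R' ?r) (\<eta>' (onOb P K))
        = Comp \<D>' (Comp \<D>' (onArr R' (onArr Q (onArr S k))) (onArr R' (m K))) (\<eta>' (onOb P K))"
      by (subst functor_Comp[OF fR' _ _ _ mH QSk]) (intro refl KO)+
    also have "\<dots> = Comp \<D>' (onArr R' (onArr Q (onArr S k))) (w K)"
      unfolding mw[OF K, symmetric]
      by (rule Comp_assoc[OF cats(1) _ _ _ _ \<eta>' R'm R'QSk]) (intro KO)+
    also have "\<dots> = Comp \<D>' (Comp \<D>' (onArr R' (onArr Q (onArr S k))) (\<beta> (onOb S K))) (onArr P (\<eta> K))"
      unfolding w_def
      by (rule Comp_assoc[OF cats(1) _ _ _ _ p\<eta> \<beta>H R'QSk, symmetric]) (intro KO)+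
    also have "\<dots> = Comp \<D>' (Comp \<D>' (\<beta> (onOb S K')) (onArr P (onArr R (onArr S k)))) (onArr P (\<eta> K))"
      using nat_trans_natural[OF \<beta> _ _ Sk] KO by simp
    also have "\<dots> = Comp \<D>' (\<beta> (onOb S K')) (Comp \<D>' (onArr P (onArr R (onArr S k))) (onArr P (\<eta> K)))"
      by (rule Comp_assoc[OF cats(1) _ _ _ _ p\<eta> PRSk \<beta>H]) (intro KO)+
    also have "Comp \<D>' (onArr P (onArr R (onArr S k))) (onArr P (\<eta> K))
        = onArr P (Comp \<D> (onArr R (onArr S k)) (\<eta> K))"
      by (rule functor_Comp[OF p _ _ _ \<eta> RSk, symmetric]) (intro KO)+
    also have "Comp \<D> (onArr R (onArr S k)) (\<eta> K) = Comp \<D> (\<eta> K') k"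
      using nat_trans_natural[OF n K K' k] by simp
    also have "onArr P \<dots> = Comp \<D>' (onArr P (\<eta> K')) (onArr P k)"
      by (rule functor_Comp[OF p _ _ _ k \<eta>]) (intro KO)+
    also have "Comp \<D>' (\<beta> (onOb S K')) \<dots> = ?u"
      unfolding w_def
      by (rule Comp_assoc[OF cats(1) _ _ _ _ Pk p\<eta> \<beta>H, symmetric]) (intro KO)+
    finally have r: "Comp \<D>' (onArr R' ?r) (\<eta>' (onOb P K)) = ?u" .
    have "\<exists>!v. v \<in> Hom \<C>' (onOb S' (onOb P K)) (onOb Q (onOb S K')) \<and>
        Comp \<D>' (onArr R' v) (\<eta>' (onOb P K)) = ?u"
      by (intro left_adjoint_unique[OF adj'] uH KO)
    then have "?l = ?r" using l r lH rH by blast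
    then show "Comp \<C>' (m K') (onArr (S' \<cdot>\<^sub>F P) k) = Comp \<C>' (onArr (Q \<cdot>\<^sub>F S) k) (m K)"
      by simp
  qed
  moreover have "m' = m"
    if m': "nat_trans \<D> \<C>' (S' \<cdot>\<^sub>F P) (Q \<cdot>\<^sub>F S) m'"
      "\<forall>K\<in>Ob \<D>. Comp \<D>' (onArr R' (m' K)) (\<eta>' (onOb P K)) = w K" for m'
  proof (rule nat_trans_ext[OF m'(1) calculation])
    fix K assume K: "K \<in> Ob \<D>"
    show "m' K = m K"
      using ex1[OF K] nat_trans_Hom[OF m'(1) K, unfolded compF_simps] bspec[OF m'(2) K] mH[OF K] mw[OF K]
      by blast
  qed
  ultimately show ?thesis
    unfolding w_def[symmetric] using mw by blast
qed


section \<open>Calculus of zigzags modulo equivalence, and its compatibility with functors and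
  natural transformations\<close>

section \<open>Localisation\<close>

lemma zigzag_Ob: "zigzag \<C> W A w B \<Longrightarrow> A \<in> Ob \<C> \<and> B \<in> Ob \<C>"
  by (induction rule: zigzag.induct) auto

lemma zigzag_append: "zigzag \<C> W A u B \<Longrightarrow> zigzag \<C> W B v C \<Longrightarrow> zigzag \<C> W A (u @ v) C"
  by (induction rule: zigzag.induct) (auto intro: zigzag.intros)

lemma zigzag_Fwd: "\<lbrakk>A \<in> Ob \<C>; B \<in> Ob \<C>; f \<in> Hom \<C> A B\<rbrakk> \<Longrightarrow> zigzag \<C> W A [Fwd f] B"
  by (auto intro: zigzag.intros)

lemma zigzag_Bwd: "\<lbrakk>A \<in> Ob \<C>; B \<in> Ob \<C>; s \<in> W; s \<in> Hom \<C> A B\<rbrakk> \<Longrightarrow> zigzag \<C> W B [Bwd s] A"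
  by (auto intro: zigzag.intros)

text \<open>The rules \<open>zz_idn\<close> and \<open>zz_comp\<close> introduce identities and
  composites of \<C>; a precategory types them, so the equivalence never leaves the zigzags with the
  given ends.\<close>

lemma zz_eq_zigzag:
  assumes "is_precategory \<C>" "zz_eq \<C> W A B v w"
  shows "zigzag \<C> W A v B \<and> zigzag \<C> W A w B"
  using assms(2)
proof induction
  case (zz_idn A)
  then show ?case using Idn_in_Hom[OF assms(1)] by (auto intro: zigzag.intros)
next
  case (zz_comp A B C f g)
  then show ?case using Comp_in_Hom[OF assms(1), of A B C f g] by (auto intro: zigzag.intros)
qed (auto intro: zigzag.intros zigzag_append)

text \<open>\<open>zz_ctx\<close> changes one factor inside a fixed context, so the two factors are
  replaced one after the other.\<close>

lemma zz_eq_append: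
  assumes pc: "is_precategory \<C>" and "zz_eq \<C> W A B u u'" "zz_eq \<C> W B C v v'"
  shows "zz_eq \<C> W A C (u @ v) (u' @ v')"
proof -
  have "zigzag \<C> W A u' B" "zigzag \<C> W B v C"
    using assms zz_eq_zigzag[OF pc] by blast+
  then have "zigzag \<C> W A [] A" "zigzag \<C> W C [] C"
    using zigzag_Ob zz_nil by metis+
  have "zz_eq \<C> W A C ([] @ u @ v) ([] @ u' @ v)"
    using \<open>zigzag \<C> W A [] A\<close> assms(2) \<open>zigzag \<C> W B v C\<close> by (rule zz_ctx)
  moreover have "zz_eq \<C> W A C (u' @ v @ []) (u' @ v' @ [])"
    using \<open>zigzag \<C> W A u' B\<close> assms(3) \<open>zigzag \<C> W C [] C\<close> by (rule zz_ctx)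
  ultimately show ?thesis by (auto intro: zz_trans)
qed

lemma zz_class_eqI: "zz_eq \<C> W A B v w \<Longrightarrow> zz_class \<C> W A B v = zz_class \<C> W A B w"
  by (auto simp: zz_class_def intro: zz_sym zz_trans)

lemma Ob_localization [simp]: "Ob (localization \<C> W) = Ob \<C>"
  by (simp add: localization_def)

lemma Idn_localization [simp]: "Idn (localization \<C> W) A = zz_class \<C> W A A []"
  by (simp add: localization_def)

lemma Hom_localization:
  "h \<in> Hom (localization \<C> W) A B \<longleftrightarrow> (\<exists>w. zigzag \<C> W A w B \<and> h = zz_class \<C> W A B w)"
  by (auto simp: Hom_def localization_def zz_class_def)

text \<open>\<open>Comp\<close> is defined without representatives, by saturating all concatenations
  of members of the two classes; congruence under concatenation collapses this to a single class.
  The zigzag of the arrow applied first stands first, opposite to the argument order of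
  \<open>Comp\<close>.\<close>

lemma Comp_localization:
  assumes pc: "is_precategory \<C>" and u: "zigzag \<C> W A u B" and v: "zigzag \<C> W B v C"
  shows "Comp (localization \<C> W) (zz_class \<C> W B C v) (zz_class \<C> W A B u) = zz_class \<C> W A C (u @ v)"
proof -
  have "zz_eq \<C> W A C (u' @ v') w \<Longrightarrow> zz_eq \<C> W A C (u @ v) w"
    if "zz_eq \<C> W A B u u'" "zz_eq \<C> W B C v v'" for u' v' w
    using zz_eq_append[OF pc that] by (rule zz_trans)
  then show ?thesis
    using zz_refl[OF u] zz_refl[OF v] by (auto simp: localization_def zz_class_def)
qed

text \<open>Unit and associativity laws are those of list concatenation. From \<C> only the typing
  of identities and composites enters, which is why \<open>is_precategory\<close> is kept apart from
  \<open>is_category\<close>.\<close>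

lemma is_category_localization:
  assumes pc: "is_precategory \<C>"
  shows "is_category (localization \<C> W)"
proof -
  note C = Comp_localization[OF pc]
  show ?thesis
    unfolding is_category_def is_precategory_def Ob_localization
  proof (intro conjI ballI)
    fix A assume "A \<in> Ob \<C>"
    then show "Idn (localization \<C> W) A \<in> Hom (localization \<C> W) A A"
      using zz_nil by (force simp: Hom_localization)
  next
    fix A B C f g
    assume "f \<in> Hom (localization \<C> W) A B" "g \<in> Hom (localization \<C> W) B C"
    then show "Comp (localization \<C> W) g f \<in> Hom (localization \<C> W) A C"
      by (auto simp: Hom_localization C intro: zigzag_append)
  next
    fix A B f assume "A \<in> Ob \<C>" "B \<in> Ob \<C>" "f \<in> Hom (localization \<C> W) A B"
    then show "Comp (localization \<C> W) f (Idn (localization \<C> W) A) = f"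
      "Comp (localization \<C> W) (Idn (localization \<C> W) B) f = f"
      by (auto simp: Hom_localization C zz_nil)
  next
    fix A B C D f g h
    assume "f \<in> Hom (localization \<C> W) A B" "g \<in> Hom (localization \<C> W) B C"
      "h \<in> Hom (localization \<C> W) C D"
    then show "Comp (localization \<C> W) h (Comp (localization \<C> W) g f)
        = Comp (localization \<C> W) (Comp (localization \<C> W) h g) f"
      by (auto simp: Hom_localization C zigzag_append)
  qed
qed

lemma onOb_loc_functor [simp]: "onOb (loc_functor \<C> W) A = A"
  by (simp add: loc_functor_def)

lemma onArr_loc_functor:
  "f \<in> Hom \<C> A B \<Longrightarrow> onArr (loc_functor \<C> W) f = zz_class \<C> W A B [Fwd f]"
  by (auto simp: loc_functor_def Hom_def)

lemma is_functor_loc_functor: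
  assumes pc: "is_precategory \<C>"
  shows "is_functor \<C> (localization \<C> W) (loc_functor \<C> W)"
  unfolding is_functor_def
proof (intro conjI ballI)
  fix A assume A: "A \<in> Ob \<C>"
  then show "onOb (loc_functor \<C> W) A \<in> Ob (localization \<C> W)" by simp
  show "onArr (loc_functor \<C> W) (Idn \<C> A) = Idn (localization \<C> W) (onOb (loc_functor \<C> W) A)"
    using A by (simp add: onArr_loc_functor[OF Idn_in_Hom[OF pc A]] zz_class_eqI zz_idn)
next
  fix A B f assume "A \<in> Ob \<C>" "B \<in> Ob \<C>" "f \<in> Hom \<C> A B"
  then show "onArr (loc_functor \<C> W) f
      \<in> Hom (localization \<C> W) (onOb (loc_functor \<C> W) A) (onOb (loc_functor \<C> W) B)"
    by (auto simp: onArr_loc_functor Hom_localization intro: zigzag_Fwd)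
next
  fix A B C f g
  assume *: "A \<in> Ob \<C>" "B \<in> Ob \<C>" "C \<in> Ob \<C>" "f \<in> Hom \<C> A B" "g \<in> Hom \<C> B C"
  have "zz_class \<C> W A C [Fwd (Comp \<C> g f)] = zz_class \<C> W A C ([Fwd f] @ [Fwd g])"
    using zz_comp[OF *] by (auto intro: zz_class_eqI zz_sym)
  then show "onArr (loc_functor \<C> W) (Comp \<C> g f)
      = Comp (localization \<C> W) (onArr (loc_functor \<C> W) g) (onArr (loc_functor \<C> W) f)"
    using * by (simp add: onArr_loc_functor[OF Comp_in_Hom[OF pc *]] onArr_loc_functor[OF *(4)]
        onArr_loc_functor[OF *(5)] Comp_localization[OF pc] zigzag_Fwd)
qed

text \<open>The class of a list that is not a zigzag is empty, and composing with it gives an empty class.\<close>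

lemma Hom_if_Comp_loc_functor:
  assumes pc: "is_precategory \<C>"
    and c: "Comp (localization \<C> W) (onArr (loc_functor \<C> W) g) h \<in> Hom (localization \<C> W) A B"
  shows "Src \<C> g \<in> Ob \<C> \<and> Tgt \<C> g \<in> Ob \<C> \<and> g \<in> Hom \<C> (Src \<C> g) (Tgt \<C> g)"
proof -
  obtain w where w: "zigzag \<C> W A w B"
      "Comp (localization \<C> W) (onArr (loc_functor \<C> W) g) h = zz_class \<C> W A B w"
    using c by (auto simp: Hom_localization)
  obtain a k b where h: "h = (a, k, b)" by (cases h)
  have "w \<in> fst (snd (zz_class \<C> W A B w))" using zz_refl[OF w(1)] by (simp add: zz_class_def)
  then have "w \<in> fst (snd (Comp (localization \<C> W) (onArr (loc_functor \<C> W) g) h))" using w(2) by simp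
  then obtain v where "zz_eq \<C> W (Src \<C> g) (Tgt \<C> g) [Fwd g] v"
    by (auto simp: h loc_functor_def zz_class_def localization_def)
  then have z: "zigzag \<C> W (Src \<C> g) [Fwd g] (Tgt \<C> g)" using zz_eq_zigzag[OF pc] by blast
  then have "g \<in> Hom \<C> (Src \<C> g) (Tgt \<C> g)"
    by (auto elim!: zigzag.cases[of _ _ _ "_ # _"] zigzag.cases[of _ _ _ "[]"])
  then show ?thesis using zigzag_Ob[OF z] by simp
qed

lemma zigzag_map:
  assumes "is_functor \<C> \<D> F" "onArr F ` W \<subseteq> V" "zigzag \<C> W A w B"
  shows "zigzag \<D> V (onOb F A) (map (map_zigzag_step (onArr F)) w) (onOb F B)"
  using assms(3)
proof induction
  case (zz_nil A)
  then show ?case by (auto intro: zigzag.intros functor_Ob[OF assms(1)])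
next
  case (zz_fwd A f B w C)
  then have "onArr F f \<in> Hom \<D> (onOb F A) (onOb F B)"
    using zigzag_Ob[OF zz_fwd(3)] functor_Hom[OF assms(1)] by blast
  then show ?case using zz_fwd by (auto intro: zigzag.intros functor_Ob[OF assms(1)])
next
  case (zz_bwd A s B w C)
  then have "onArr F s \<in> Hom \<D> (onOb F B) (onOb F A)"
    using zigzag_Ob[OF zz_bwd(4)] functor_Hom[OF assms(1)] by blast
  then show ?case
    using zz_bwd assms(2) by (auto intro!: zigzag.intros(3) functor_Ob[OF assms(1)])
qed

text \<open>A functor carries each generating relation to one of the same shape; the inclusion of
  F(W) in V is what admits backward steps and the two inverse relations.\<close>

lemma zz_eq_map:
  assumes F: "is_functor \<C> \<D> F" "onArr F ` W \<subseteq> V" and "zz_eq \<C> W A B v w"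
  shows "zz_eq \<D> V (onOb F A) (onOb F B)
    (map (map_zigzag_step (onArr F)) v) (map (map_zigzag_step (onArr F)) w)"
  using assms(3)
proof induction
  case (zz_refl A w B)
  then show ?case by (intro zz_eq.zz_refl zigzag_map[OF F])
next
  case (zz_sym A B v w)
  show ?case by (rule zz_eq.zz_sym[OF zz_sym.IH])
next
  case (zz_trans A B u v w)
  show ?case by (rule zz_eq.zz_trans[OF zz_trans.IH])
next
  case (zz_ctx A u A' B' w w' v B)
  then show ?case by (auto intro: zz_eq.zz_ctx zigzag_map[OF F])
next
  case (zz_idn A)
  then show ?case by (auto simp: functor_Idn[OF F(1)] intro: zz_eq.zz_idn functor_Ob[OF F(1)])
next
  case (zz_comp A B C f g)
  then show ?case
    using zz_eq.zz_comp[of "onOb F A" \<D> "onOb F B" "onOb F C" "onArr F f" "onArr F g" V]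
    by (simp add: functor_Comp[OF F(1), of A B C] functor_Ob[OF F(1)] functor_Hom[OF F(1)])
next
  case (zz_inv1 A B s)
  then show ?case using F(2)
    by (auto intro!: zz_eq.zz_inv1[of _ _ "onOb F B"] functor_Ob[OF F(1)] functor_Hom[OF F(1)])
next
  case (zz_inv2 A B s)
  then show ?case using F(2)
    by (auto intro!: zz_eq.zz_inv2[of "onOb F A"] functor_Ob[OF F(1)] functor_Hom[OF F(1)])
qed

lemma onOb_induced_functor [simp]: "onOb (induced_functor \<D> V F) = onOb F"
  by (simp add: induced_functor_def)

text \<open>\<open>induced_functor\<close> saturates the images of all members of a class. By
  \<open>zz_eq_map\<close> these images are equivalent, so any representative computes the
  value.\<close>

lemma onArr_induced_functor:
  assumes F: "is_functor \<C> \<D> F" "onArr F ` W \<subseteq> V" and w: "zigzag \<C> W A w B"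
  shows "onArr (induced_functor \<D> V F) (zz_class \<C> W A B w)
    = zz_class \<D> V (onOb F A) (onOb F B) (map (map_zigzag_step (onArr F)) w)"
  using zz_refl[OF w] by (auto simp: induced_functor_def zz_class_def
      intro: zz_eq.zz_trans[OF zz_eq_map[OF F]])

lemma onArr_induced_loc_functor:
  assumes "is_functor \<C> \<D> F" "onArr F ` W \<subseteq> V" "A \<in> Ob \<C>" "B \<in> Ob \<C>" "f \<in> Hom \<C> A B"
  shows "onArr (induced_functor \<D> V F) (onArr (loc_functor \<C> W) f) = onArr (loc_functor \<D> V) (onArr F f)"
  using assms by (simp add: onArr_loc_functor[OF functor_Hom[OF assms(1,3-5)]]
      onArr_loc_functor[OF assms(5)] onArr_induced_functor zigzag_Fwd)

lemma is_functor_induced: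
  assumes pc: "is_precategory \<C>" "is_precategory \<D>"
    and F: "is_functor \<C> \<D> F" "onArr F ` W \<subseteq> V"
  shows "is_functor (localization \<C> W) (localization \<D> V) (induced_functor \<D> V F)"
  unfolding is_functor_def
proof (intro conjI ballI)
  fix A assume A: "A \<in> Ob (localization \<C> W)"
  then show "onOb (induced_functor \<D> V F) A \<in> Ob (localization \<D> V)"
    using functor_Ob[OF F(1)] by simp
  show "onArr (induced_functor \<D> V F) (Idn (localization \<C> W) A)
      = Idn (localization \<D> V) (onOb (induced_functor \<D> V F) A)"
    using A by (simp add: onArr_induced_functor[OF F zz_nil])
next
  fix A B f assume "f \<in> Hom (localization \<C> W) A B"
  then show "onArr (induced_functor \<D> V F) f
      \<in> Hom (localization \<D> V) (onOb (induced_functor \<D> V F) A) (onOb (induced_functor \<D> V F) B)"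
    using onArr_induced_functor[OF F] zigzag_map[OF F] by (force simp: Hom_localization)
next
  fix A B C f g assume "f \<in> Hom (localization \<C> W) A B" "g \<in> Hom (localization \<C> W) B C"
  then obtain u v where "zigzag \<C> W A u B" "f = zz_class \<C> W A B u"
      "zigzag \<C> W B v C" "g = zz_class \<C> W B C v"
    by (auto simp: Hom_localization)
  then show "onArr (induced_functor \<D> V F) (Comp (localization \<C> W) g f)
      = Comp (localization \<D> V) (onArr (induced_functor \<D> V F) g) (onArr (induced_functor \<D> V F) f)"
    by (simp add: Comp_localization[OF pc(1)] Comp_localization[OF pc(2)] zigzag_append
        onArr_induced_functor[OF F] zigzag_map[OF F])
qed

text \<open>Every arrow of the localisation is a word in arrows of \<C> and formal inverses.
  Commuting squares paste along composition (\<open>paste\<close>), and the square of an invertible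
  arrow yields that of its inverse, so naturality on \<C> suffices. This is the 2-dimensional half
  of the universal property of localisation.\<close>

lemma nat_trans_localizationI:
  assumes pc: "is_precategory \<C>" and cat: "is_category \<E>"
    and F: "is_functor (localization \<C> W) \<E> F" and G: "is_functor (localization \<C> W) \<E> G"
    and \<tau>: "nat_trans \<C> \<E> (F \<cdot>\<^sub>F loc_functor \<C> W) (G \<cdot>\<^sub>F loc_functor \<C> W) \<tau>"
  shows "nat_trans (localization \<C> W) \<E> F G \<tau>"
proof -
  let ?L = "localization \<C> W"
  note FO = functor_Ob[OF F, simplified] and GO = functor_Ob[OF G, simplified]
    and FH = functor_Hom[OF F, simplified] and GH = functor_Hom[OF G, simplified]
    and FC = functor_Comp[OF F, simplified] and GC = functor_Comp[OF G, simplified]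
    and FI = functor_Idn[OF F, simplified] and GI = functor_Idn[OF G, simplified]
    and pcE = is_category_imp_precategory[OF cat]
  have \<tau>H: "\<tau> A \<in> Hom \<E> (onOb F A) (onOb G A)" if "A \<in> Ob \<C>" for A
    using nat_trans_Hom[OF \<tau> that] by simp
  have \<tau>f: "Comp \<E> (\<tau> B) (onArr F (zz_class \<C> W A B [Fwd f]))
      = Comp \<E> (onArr G (zz_class \<C> W A B [Fwd f])) (\<tau> A)"
    if "A \<in> Ob \<C>" "B \<in> Ob \<C>" "f \<in> Hom \<C> A B" for A B f
    using nat_trans_natural[OF \<tau> that] by (simp add: onArr_loc_functor[OF that(3)])
  have paste: "Comp \<E> (\<tau> C) (onArr F (Comp ?L g f)) = Comp \<E> (onArr G (Comp ?L g f)) (\<tau> A)"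
    if O: "A \<in> Ob \<C>" "B \<in> Ob \<C>" "C \<in> Ob \<C>" and f: "f \<in> Hom ?L A B" and g: "g \<in> Hom ?L B C"
      and nf: "Comp \<E> (\<tau> B) (onArr F f) = Comp \<E> (onArr G f) (\<tau> A)"
      and ng: "Comp \<E> (\<tau> C) (onArr F g) = Comp \<E> (onArr G g) (\<tau> B)" for A B C f g
  proof -
    note Ff = FH[OF O(1,2) f] and Fg = FH[OF O(2,3) g] and Gf = GH[OF O(1,2) f] and Gg = GH[OF O(2,3) g]
    have "Comp \<E> (\<tau> C) (onArr F (Comp ?L g f)) = Comp \<E> (Comp \<E> (\<tau> C) (onArr F g)) (onArr F f)"
      using Comp_assoc[OF cat _ _ _ _ Ff Fg \<tau>H] O by (simp add: FC[OF O f g] FO GO)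
    also have "\<dots> = Comp \<E> (onArr G g) (Comp \<E> (\<tau> B) (onArr F f))"
      using Comp_assoc[OF cat _ _ _ _ Ff \<tau>H Gg] O by (simp add: ng FO GO)
    also have "\<dots> = Comp \<E> (onArr G (Comp ?L g f)) (\<tau> A)"
      using Comp_assoc[OF cat _ _ _ _ \<tau>H Gf Gg] O by (simp add: nf GC[OF O f g] FO GO)
    finally show ?thesis .
  qed
  have zz: "Comp \<E> (\<tau> B) (onArr F (zz_class \<C> W A B w)) = Comp \<E> (onArr G (zz_class \<C> W A B w)) (\<tau> A)"
    if "zigzag \<C> W A w B" for A B w
    using that
  proof induction
    case (zz_nil A)
    then show ?case
      using FI[of A] GI[of A] Comp_Idn[OF cat _ _ \<tau>H] FO GO by simp
  next
    case (zz_fwd A f B w C)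
    then have O: "A \<in> Ob \<C>" "B \<in> Ob \<C>" "C \<in> Ob \<C>" using zigzag_Ob by metis+
    have z: "zigzag \<C> W A [Fwd f] B" using O zz_fwd by (intro zigzag_Fwd)
    have "zz_class \<C> W A C (Fwd f # w) = Comp ?L (zz_class \<C> W B C w) (zz_class \<C> W A B [Fwd f])"
      using Comp_localization[OF pc z zz_fwd(3)] by simp
    then show ?case
      using paste[OF O _ _ \<tau>f zz_fwd.IH] O zz_fwd z by (auto simp: Hom_localization)
  next
    case (zz_bwd A s B w C)
    then have O: "A \<in> Ob \<C>" "B \<in> Ob \<C>" "C \<in> Ob \<C>" using zigzag_Ob by metis+
    let ?s = "zz_class \<C> W B A [Fwd s]" and ?t = "zz_class \<C> W A B [Bwd s]"
    have zs: "zigzag \<C> W B [Fwd s] A" using O zz_bwd by (intro zigzag_Fwd)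
    have z: "zigzag \<C> W A [Bwd s] B" using O zz_bwd by (intro zigzag_Bwd)
    have s: "?s \<in> Hom ?L B A" and t: "?t \<in> Hom ?L A B" using zs z by (auto simp: Hom_localization)
    have ts: "Comp ?L ?t ?s = Idn ?L B" and st: "Comp ?L ?s ?t = Idn ?L A"
      using O zz_bwd zz_inv1[of B \<C> A s W] zz_inv2[of B \<C> A s W]
      by (auto simp: Comp_localization[OF pc z zs] Comp_localization[OF pc zs z] intro: zz_class_eqI)
    note Fs = FH[OF O(2,1) s] and Ft = FH[OF O(1,2) t] and Gs = GH[OF O(2,1) s] and Gt = GH[OF O(1,2) t]
    \<comment> \<open>\<open>?t\<close> is the inverse of \<open>?s\<close>. Insert the identity G
      \<open>?t\<close> after G \<open>?s\<close> on the left, cross the known square of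
      \<open>?s\<close>, and cancel F \<open>?s\<close> against F \<open>?t\<close> on the
      right.\<close>
    have "Comp \<E> (\<tau> B) (onArr F ?t) = Comp \<E> (Comp \<E> (onArr G ?t) (onArr G ?s)) (Comp \<E> (\<tau> B) (onArr F ?t))"
      using GC[OF O(2,1,2) s t] GI[OF O(2)] ts FO GO O
        Comp_Idn_left[OF cat _ _ Comp_in_Hom[OF pcE _ _ _ Ft \<tau>H]] by simp
    also have "\<dots> = Comp \<E> (onArr G ?t) (Comp \<E> (onArr G ?s) (Comp \<E> (\<tau> B) (onArr F ?t)))"
      using Comp_assoc[OF cat _ _ _ _ Comp_in_Hom[OF pcE _ _ _ Ft \<tau>H] Gs Gt] O FO GO by simp
    also have "Comp \<E> (onArr G ?s) (Comp \<E> (\<tau> B) (onArr F ?t))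
        = Comp \<E> (Comp \<E> (onArr G ?s) (\<tau> B)) (onArr F ?t)"
      using Comp_assoc[OF cat _ _ _ _ Ft \<tau>H Gs] O FO GO by simp
    also have "\<dots> = Comp \<E> (Comp \<E> (\<tau> A) (onArr F ?s)) (onArr F ?t)"
      using \<tau>f[of B A s] zz_bwd O by simp
    also have "\<dots> = Comp \<E> (\<tau> A) (Comp \<E> (onArr F ?s) (onArr F ?t))"
      using Comp_assoc[OF cat _ _ _ _ Ft Fs \<tau>H] O FO GO by simp
    also have "\<dots> = \<tau> A"
      unfolding FC[OF O(1,2,1) t s, symmetric] st Idn_localization FI[OF O(1)]
      using FO GO O by (intro Comp_Idn_right[OF cat _ _ \<tau>H])
    finally have nt: "Comp \<E> (\<tau> B) (onArr F ?t) = Comp \<E> (onArr G ?t) (\<tau> A)" .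
    have "zz_class \<C> W A C (Bwd s # w) = Comp ?L (zz_class \<C> W B C w) ?t"
      using Comp_localization[OF pc z zz_bwd(4)] by simp
    then show ?case
      using paste[OF O t _ nt zz_bwd.IH] zz_bwd by (auto simp: Hom_localization)
  qed
  show ?thesis
  proof (rule nat_transI)
    show "\<tau> \<in> extensional (Ob ?L)" using \<tau> by (simp add: nat_trans_def)
  qed (use \<tau>H zz in \<open>auto simp: Hom_localization\<close>)
qed

section \<open>Left derived functors under precomposition with a reflector\<close>

section \<open>Derived functors and restriction along a reflector\<close>

text \<open>Precomposition with a reflector \<open>R\<close> of localised categories is right adjoint to precomposition
  with its section \<open>E\<close>, hence preserves the right Kan extension that \<open>L\<close> is.\<close>

lemma is_left_derived_reflector:
  assumes pc: "is_precategory \<C>" "is_precategory \<C>'" "is_precategory \<D>"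
    and R: "is_functor \<C> \<C>' R" "onArr R ` W \<subseteq> W'"
    and E: "is_functor \<C>' \<C> E" "onArr E ` W' \<subseteq> W"
    and RE_Ob: "\<And>B. B \<in> Ob \<C>' \<Longrightarrow> onOb R (onOb E B) = B"
    and RE_Arr: "\<And>B B' g. \<lbrakk>B \<in> Ob \<C>'; B' \<in> Ob \<C>'; g \<in> Hom \<C>' B B'\<rbrakk> \<Longrightarrow> onArr R (onArr E g) = g"
    and u: "\<And>A. A \<in> Ob \<C> \<Longrightarrow> u A \<in> Hom \<C> A (onOb E (onOb R A))"
    and u_nat: "\<And>A A' f. \<lbrakk>A \<in> Ob \<C>; A' \<in> Ob \<C>; f \<in> Hom \<C> A A'\<rbrakk>
      \<Longrightarrow> Comp \<C> (u A') f = Comp \<C> (onArr E (onArr R f)) (u A)"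
    and Ru: "\<And>A. A \<in> Ob \<C> \<Longrightarrow> onArr R (u A) = Idn \<C>' (onOb R A)"
    and L: "is_left_derived \<C>' W' \<D> V F L \<epsilon>"
  shows "is_left_derived \<C> W \<D> V (F \<cdot>\<^sub>F R) (L \<cdot>\<^sub>F induced_functor \<C>' W' R)
    (\<lambda>A\<in>Ob \<C>. \<epsilon> (onOb R A))"
proof -
  let ?C = "localization \<C> W" and ?C' = "localization \<C>' W'" and ?D = "localization \<D> V"
  let ?Q = "loc_functor \<C> W" and ?Q' = "loc_functor \<C>' W'" and ?P = "loc_functor \<D> V"
  let ?R = "induced_functor \<C>' W' R" and ?E = "induced_functor \<C> W E"
  have catD: "is_category ?D" by (rule is_category_localization[OF pc(3)])
  note pcD = is_category_imp_precategory[OF catD]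
  have fL: "is_functor ?C' ?D L"
    and n\<epsilon>: "nat_trans \<C>' ?D (L \<cdot>\<^sub>F ?Q') (?P \<cdot>\<^sub>F F) \<epsilon>"
    using L by (simp_all add: is_left_derived_def)
  have terminal: "\<exists>!\<tau>. nat_trans ?C' ?D G L \<tau> \<and> (\<forall>A\<in>Ob \<C>'. Comp ?D (\<epsilon> A) (\<tau> A) = \<alpha> A)"
    if "is_functor ?C' ?D G" "nat_trans \<C>' ?D (G \<cdot>\<^sub>F ?Q') (?P \<cdot>\<^sub>F F) \<alpha>" for G \<alpha>
    using L that by (simp add: is_left_derived_def)
  have fR: "is_functor ?C ?C' ?R" and fE: "is_functor ?C' ?C ?E"
    by (intro is_functor_induced pc R E)+
  have fLR: "is_functor ?C ?D (L \<cdot>\<^sub>F ?R)" by (rule is_functor_compF[OF fR fL])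
  have fQ: "is_functor \<C> ?C ?Q" and fQ': "is_functor \<C>' ?C' ?Q'"
    by (intro is_functor_loc_functor pc)+
  note RO = functor_Ob[OF R(1)] and EO = functor_Ob[OF E(1)]
    and RH = functor_Hom[OF R(1)] and EH = functor_Hom[OF E(1)]
    and RQ = onArr_induced_loc_functor[OF R] and EQ = onArr_induced_loc_functor[OF E]
    and LO = functor_Ob[OF fL, simplified]
  have QH: "onArr ?Q f \<in> Hom ?C A B" if "A \<in> Ob \<C>" "B \<in> Ob \<C>" "f \<in> Hom \<C> A B" for A B f
    using functor_Hom[OF fQ that] by simp
  \<comment> \<open>The unit becomes an identity under R, hence also under L after R. In the
    uniqueness argument this cancels the unit.\<close>
  have LRu: "onArr L (onArr ?R (onArr ?Q (u A))) = Idn ?D (onOb L (onOb R A))" if "A \<in> Ob \<C>" for A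
    using that functor_Idn[OF fQ', of "onOb R A"] functor_Idn[OF fL, of "onOb R A"]
    by (simp add: RQ[OF _ _ u] Ru RO EO)
  \<comment> \<open>F is just a pair of maps here. That \<open>onOb F B\<close> is an object is read
    off from \<epsilon>, because a zigzag can only end at an object.\<close>
  have \<epsilon>H: "\<epsilon> B \<in> Hom ?D (onOb L B) (onOb F B)" and FO: "onOb F B \<in> Ob \<D>" if "B \<in> Ob \<C>'" for B
  proof -
    show *: "\<epsilon> B \<in> Hom ?D (onOb L B) (onOb F B)"
      using nat_trans_Hom[OF n\<epsilon> that] by simp
    then show "onOb F B \<in> Ob \<D>" using zigzag_Ob by (force simp: Hom_localization)
  qed
  show ?thesis
    unfolding is_left_derived_def
  proof (intro conjI allI impI)
    show "is_functor ?C ?D (L \<cdot>\<^sub>F ?R)" by (rule fLR)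
  next
    show "nat_trans \<C> ?D ((L \<cdot>\<^sub>F ?R) \<cdot>\<^sub>F ?Q) (?P \<cdot>\<^sub>F F \<cdot>\<^sub>F R) (\<lambda>A\<in>Ob \<C>. \<epsilon> (onOb R A))"
    proof (rule nat_transI)
      fix A assume "A \<in> Ob \<C>"
      then show "(\<lambda>A\<in>Ob \<C>. \<epsilon> (onOb R A)) A \<in> Hom ?D (onOb ((L \<cdot>\<^sub>F ?R) \<cdot>\<^sub>F ?Q) A) (onOb (?P \<cdot>\<^sub>F F \<cdot>\<^sub>F R) A)"
        using \<epsilon>H RO by simp
    next
      fix A B f assume "A \<in> Ob \<C>" "B \<in> Ob \<C>" "f \<in> Hom \<C> A B"
      then show "Comp ?D ((\<lambda>A\<in>Ob \<C>. \<epsilon> (onOb R A)) B) (onArr ((L \<cdot>\<^sub>F ?R) \<cdot>\<^sub>F ?Q) f)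
          = Comp ?D (onArr (?P \<cdot>\<^sub>F F \<cdot>\<^sub>F R) f) ((\<lambda>A\<in>Ob \<C>. \<epsilon> (onOb R A)) A)"
        using nat_trans_natural[OF n\<epsilon> _ _ RH[of A B f]] by (simp add: RQ[of A B f] RO)
    qed simp
  next
    fix G \<alpha>
    assume "is_functor ?C ?D G \<and> nat_trans \<C> ?D (G \<cdot>\<^sub>F ?Q) (?P \<cdot>\<^sub>F F \<cdot>\<^sub>F R) \<alpha>"
    then have fG: "is_functor ?C ?D G" and n\<alpha>: "nat_trans \<C> ?D (G \<cdot>\<^sub>F ?Q) (?P \<cdot>\<^sub>F F \<cdot>\<^sub>F R) \<alpha>" by auto
    note GO = functor_Ob[OF fG, simplified]
    have fGE: "is_functor ?C' ?D (G \<cdot>\<^sub>F ?E)" by (rule is_functor_compF[OF fE fG])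
    have GH: "onArr G (onArr ?Q f) \<in> Hom ?D (onOb G A) (onOb G B)"
      if "A \<in> Ob \<C>" "B \<in> Ob \<C>" "f \<in> Hom \<C> A B" for A B f
      using functor_Hom[OF fG _ _ QH[OF that]] that by simp
    have GuH: "onArr G (onArr ?Q (u A)) \<in> Hom ?D (onOb G A) (onOb G (onOb E (onOb R A)))"
      if "A \<in> Ob \<C>" for A
      using that by (intro GH u EO RO)
    have \<alpha>H: "\<alpha> A \<in> Hom ?D (onOb G A) (onOb F (onOb R A))" if "A \<in> Ob \<C>" for A
      using nat_trans_Hom[OF n\<alpha> that] by simp
    \<comment> \<open>To compare a competitor G with L, it is pulled back along E. Since R after E
      is the identity on objects, the arrow \<alpha> at E B already ends in F B.\<close>
    define \<alpha>E where "\<alpha>E = (\<lambda>B\<in>Ob \<C>'. \<alpha> (onOb E B))"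
    have n\<alpha>E: "nat_trans \<C>' ?D ((G \<cdot>\<^sub>F ?E) \<cdot>\<^sub>F ?Q') (?P \<cdot>\<^sub>F F) \<alpha>E"
    proof (rule nat_transI)
      fix B assume "B \<in> Ob \<C>'"
      then show "\<alpha>E B \<in> Hom ?D (onOb ((G \<cdot>\<^sub>F ?E) \<cdot>\<^sub>F ?Q') B) (onOb (?P \<cdot>\<^sub>F F) B)"
        using \<alpha>H[OF EO] by (simp add: \<alpha>E_def RE_Ob)
    next
      fix B B' g assume g: "B \<in> Ob \<C>'" "B' \<in> Ob \<C>'" "g \<in> Hom \<C>' B B'"
      then show "Comp ?D (\<alpha>E B') (onArr ((G \<cdot>\<^sub>F ?E) \<cdot>\<^sub>F ?Q') g) = Comp ?D (onArr (?P \<cdot>\<^sub>F F) g) (\<alpha>E B)"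
        using nat_trans_natural[OF n\<alpha> _ _ EH[OF g]] by (simp add: \<alpha>E_def EQ[OF g] RE_Arr[OF g] EO)
    qed (simp add: \<alpha>E_def)
    obtain \<tau> where n\<tau>: "nat_trans ?C' ?D (G \<cdot>\<^sub>F ?E) L \<tau>"
      and \<epsilon>\<tau>: "\<And>B. B \<in> Ob \<C>' \<Longrightarrow> Comp ?D (\<epsilon> B) (\<tau> B) = \<alpha>E B"
      and \<tau>_unique: "\<And>\<tau>'. nat_trans ?C' ?D (G \<cdot>\<^sub>F ?E) L \<tau>' \<Longrightarrow>
        (\<And>B. B \<in> Ob \<C>' \<Longrightarrow> Comp ?D (\<epsilon> B) (\<tau>' B) = \<alpha>E B) \<Longrightarrow> \<tau>' = \<tau>"
      using terminal[OF fGE n\<alpha>E] by (elim ex1E) blast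
    have \<tau>H: "\<tau> B \<in> Hom ?D (onOb G (onOb E B)) (onOb L B)" if "B \<in> Ob \<C>'" for B
      using nat_trans_Hom[OF n\<tau>] that by simp
    \<comment> \<open>The transpose of \<tau>: go from G A to G (E (R A)) by the unit, then apply
      \<tau> at R A.\<close>
    define \<beta> where "\<beta> = (\<lambda>A\<in>Ob \<C>. Comp ?D (\<tau> (onOb R A)) (onArr G (onArr ?Q (u A))))"
    have \<beta>H: "\<beta> A \<in> Hom ?D (onOb G A) (onOb L (onOb R A))" if "A \<in> Ob \<C>" for A
      using Comp_in_Hom[OF pcD _ _ _ GuH \<tau>H] that by (simp add: \<beta>_def GO LO RO EO)
    have "nat_trans \<C> ?D (G \<cdot>\<^sub>F ?Q) ((L \<cdot>\<^sub>F ?R) \<cdot>\<^sub>F ?Q) \<beta>"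
    proof (rule nat_transI)
      fix A A' f assume f: "A \<in> Ob \<C>" "A' \<in> Ob \<C>" "f \<in> Hom \<C> A A'"
      note O = GO LO RO EO f(1,2)
      note Rf = RH[OF f]
      note ERf = EH[OF RO[OF f(1)] RO[OF f(2)] Rf]
      have LRf: "onArr L (onArr ?Q' (onArr R f)) \<in> Hom ?D (onOb L (onOb R A)) (onOb L (onOb R A'))"
        using functor_Hom[OF fL _ _ functor_Hom[OF fQ' _ _ Rf]] by (simp add: O)
      have "Comp ?D (\<beta> A') (onArr G (onArr ?Q f))
          = Comp ?D (\<tau> (onOb R A')) (Comp ?D (onArr G (onArr ?Q (u A'))) (onArr G (onArr ?Q f)))"
        using Comp_assoc[OF catD _ _ _ _ GH[OF f] GuH \<tau>H] by (simp add: \<beta>_def O)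
      also have "Comp ?D (onArr G (onArr ?Q (u A'))) (onArr G (onArr ?Q f))
          = onArr G (onArr ?Q (Comp \<C> (u A') f))"
        using functor_Comp[OF fG _ _ _ QH[OF f] QH[OF _ _ u]] functor_Comp[OF fQ _ _ _ f(3) u]
        by (simp add: O)
      also have "\<dots> = Comp ?D (onArr G (onArr ?Q (onArr E (onArr R f)))) (onArr G (onArr ?Q (u A)))"
        using functor_Comp[OF fG _ _ _ QH[OF _ _ u] QH[OF _ _ ERf]] functor_Comp[OF fQ _ _ _ u ERf]
        by (simp add: O u_nat[OF f])
      also have "Comp ?D (\<tau> (onOb R A')) \<dots>
          = Comp ?D (Comp ?D (\<tau> (onOb R A')) (onArr G (onArr ?Q (onArr E (onArr R f)))))
              (onArr G (onArr ?Q (u A)))"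
        using Comp_assoc[OF catD _ _ _ _ GuH GH[OF _ _ ERf] \<tau>H] by (simp add: O)
      also have "Comp ?D (\<tau> (onOb R A')) (onArr G (onArr ?Q (onArr E (onArr R f))))
          = Comp ?D (onArr L (onArr ?Q' (onArr R f))) (\<tau> (onOb R A))"
        using nat_trans_natural[OF n\<tau> _ _ functor_Hom[OF fQ' _ _ Rf]] EQ[OF _ _ Rf] by (simp add: O)
      also have "Comp ?D \<dots> (onArr G (onArr ?Q (u A))) = Comp ?D (onArr L (onArr ?Q' (onArr R f))) (\<beta> A)"
        using Comp_assoc[OF catD _ _ _ _ GuH \<tau>H LRf] by (simp add: \<beta>_def O)
      finally show "Comp ?D (\<beta> A') (onArr (G \<cdot>\<^sub>F ?Q) f) = Comp ?D (onArr ((L \<cdot>\<^sub>F ?R) \<cdot>\<^sub>F ?Q) f) (\<beta> A)"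
        by (simp add: RQ[OF f])
    qed (use \<beta>H in \<open>simp_all add: \<beta>_def\<close>)
    then have n\<beta>: "nat_trans ?C ?D G (L \<cdot>\<^sub>F ?R) \<beta>"
      by (rule nat_trans_localizationI[OF pc(1) catD fG fLR])
    have \<epsilon>\<beta>: "Comp ?D (\<epsilon> (onOb R A)) (\<beta> A) = \<alpha> A" if A: "A \<in> Ob \<C>" for A
    proof -
      note O = GO LO RO EO FO A
      have "Comp ?D (\<epsilon> (onOb R A)) (\<beta> A)
          = Comp ?D (Comp ?D (\<epsilon> (onOb R A)) (\<tau> (onOb R A))) (onArr G (onArr ?Q (u A)))"
        using Comp_assoc[OF catD _ _ _ _ GuH \<tau>H \<epsilon>H] by (simp add: \<beta>_def O)
      also have "\<dots> = Comp ?D (\<alpha> (onOb E (onOb R A))) (onArr G (onArr ?Q (u A)))"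
        using \<epsilon>\<tau>[OF RO[OF A]] RO[OF A] by (simp add: \<alpha>E_def)
      also have "\<dots> = Comp ?D (onArr ?P (onArr F (onArr R (u A)))) (\<alpha> A)"
        using nat_trans_natural[OF n\<alpha> _ _ u[OF A]] by (simp add: O)
      \<comment> \<open>F is not known to preserve identities, so the identity is kept in the form R
        (\<open>Idn \<C> A\<close>). Naturality of \<alpha> at \<open>Idn \<C> A\<close> then moves
        it to the side of G, which is a functor.\<close>
      also have "onArr R (u A) = onArr R (Idn \<C> A)"
        using Ru functor_Idn[OF R(1)] A by simp
      also have "Comp ?D (onArr ?P (onArr F (onArr R (Idn \<C> A)))) (\<alpha> A)
          = Comp ?D (\<alpha> A) (onArr G (onArr ?Q (Idn \<C> A)))"
        using nat_trans_natural[OF n\<alpha> A A Idn_in_Hom[OF pc(1) A]] by simp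
      also have "onArr G (onArr ?Q (Idn \<C> A)) = Idn ?D (onOb G A)"
        using functor_Idn[OF fQ A] functor_Idn[OF fG, of A] A by simp
      also have "Comp ?D (\<alpha> A) (Idn ?D (onOb G A)) = \<alpha> A"
        by (rule Comp_Idn_right[OF catD _ _ \<alpha>H[OF A]]) (simp_all add: O)
      finally show ?thesis .
    qed
    show "\<exists>!\<tau>. nat_trans ?C ?D G (L \<cdot>\<^sub>F ?R) \<tau> \<and>
        (\<forall>A\<in>Ob \<C>. Comp ?D ((\<lambda>A\<in>Ob \<C>. \<epsilon> (onOb R A)) A) (\<tau> A) = \<alpha> A)"
    proof (rule ex1I[of _ \<beta>])
      show "nat_trans ?C ?D G (L \<cdot>\<^sub>F ?R) \<beta> \<and>
          (\<forall>A\<in>Ob \<C>. Comp ?D ((\<lambda>A\<in>Ob \<C>. \<epsilon> (onOb R A)) A) (\<beta> A) = \<alpha> A)"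
        using n\<beta> \<epsilon>\<beta> by simp
    next
      fix \<beta>' assume "nat_trans ?C ?D G (L \<cdot>\<^sub>F ?R) \<beta>' \<and>
          (\<forall>A\<in>Ob \<C>. Comp ?D ((\<lambda>A\<in>Ob \<C>. \<epsilon> (onOb R A)) A) (\<beta>' A) = \<alpha> A)"
      then have n': "nat_trans ?C ?D G (L \<cdot>\<^sub>F ?R) \<beta>'"
        and \<epsilon>': "\<And>A. A \<in> Ob \<C> \<Longrightarrow> Comp ?D (\<epsilon> (onOb R A)) (\<beta>' A) = \<alpha> A" by auto
      have \<beta>'H: "\<beta>' A \<in> Hom ?D (onOb G A) (onOb L (onOb R A))" if "A \<in> Ob \<C>" for A
        using nat_trans_Hom[OF n', of A] that by simp
      \<comment> \<open>A second solution restricted along E solves the problem that characterises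
        \<tau>, so it equals \<tau>.\<close>
      define \<tau>' where "\<tau>' = (\<lambda>B\<in>Ob \<C>'. \<beta>' (onOb E B))"
      have "nat_trans \<C>' ?D ((G \<cdot>\<^sub>F ?E) \<cdot>\<^sub>F ?Q') (L \<cdot>\<^sub>F ?Q') \<tau>'"
      proof (rule nat_transI)
        fix B assume "B \<in> Ob \<C>'"
        then show "\<tau>' B \<in> Hom ?D (onOb ((G \<cdot>\<^sub>F ?E) \<cdot>\<^sub>F ?Q') B) (onOb (L \<cdot>\<^sub>F ?Q') B)"
          using \<beta>'H[OF EO] by (simp add: \<tau>'_def RE_Ob)
      next
        fix B B' g assume g: "B \<in> Ob \<C>'" "B' \<in> Ob \<C>'" "g \<in> Hom \<C>' B B'"
        then show "Comp ?D (\<tau>' B') (onArr ((G \<cdot>\<^sub>F ?E) \<cdot>\<^sub>F ?Q') g) = Comp ?D (onArr (L \<cdot>\<^sub>F ?Q') g) (\<tau>' B)"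
          using nat_trans_natural[OF n' _ _ QH[OF _ _ EH[OF g]]]
          by (simp add: \<tau>'_def EQ[OF g] RQ[OF _ _ EH[OF g]] RE_Arr[OF g] EO)
      qed (simp add: \<tau>'_def)
      then have "nat_trans ?C' ?D (G \<cdot>\<^sub>F ?E) L \<tau>'"
        by (rule nat_trans_localizationI[OF pc(2) catD fGE fL])
      moreover have "Comp ?D (\<epsilon> B) (\<tau>' B) = \<alpha>E B" if "B \<in> Ob \<C>'" for B
        using \<epsilon>'[OF EO[OF that]] that by (simp add: \<tau>'_def \<alpha>E_def RE_Ob)
      ultimately have "\<tau>' = \<tau>" by (rule \<tau>_unique)
      show "\<beta>' = \<beta>"
      proof (rule nat_trans_ext[OF n' n\<beta>])
        fix A assume "A \<in> Ob ?C"
        then have A: "A \<in> Ob \<C>" by simp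
        note O = GO LO RO EO A
        \<comment> \<open>Naturality of \<open>\<beta>'\<close> at the unit, together with
          \<open>LRu\<close>, recovers \<open>\<beta>'\<close> from its values on the image of E,
          where it agrees with \<tau>.\<close>
        have "\<beta> A = Comp ?D (\<beta>' (onOb E (onOb R A))) (onArr G (onArr ?Q (u A)))"
          using A RO by (simp add: \<beta>_def \<open>\<tau>' = \<tau>\<close>[symmetric] \<tau>'_def)
        also have "\<dots> = Comp ?D (onArr L (onArr ?R (onArr ?Q (u A)))) (\<beta>' A)"
          using nat_trans_natural[OF n' _ _ QH[OF _ _ u]] by (simp add: O)
        also have "\<dots> = \<beta>' A"
          unfolding LRu[OF A]
          by (rule Comp_Idn_left[OF catD _ _ \<beta>'H[OF A]]) (simp_all add: O)
        finally show "\<beta>' A = \<beta> A" by simp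
      qed
    qed
  qed
qed

section \<open>Complexes of abelian data as a precategory with quasi-isomorphisms\<close>

section \<open>Complexes of abelian data\<close>

lemma ab_homI:
  assumes "\<And>a. a \<in> carrier G \<Longrightarrow> h a \<in> carrier H"
    and "\<And>a b. \<lbrakk>a \<in> carrier G; b \<in> carrier G\<rbrakk> \<Longrightarrow> h (a \<otimes>\<^bsub>G\<^esub> b) = h a \<otimes>\<^bsub>H\<^esub> h b"
    and "h \<in> extensional (carrier G)"
  shows "h \<in> ab_hom G H"
  using assms by (simp add: ab_hom_def hom_def)

lemma ab_hom_closed: "h \<in> ab_hom G H \<Longrightarrow> a \<in> carrier G \<Longrightarrow> h a \<in> carrier H"
  by (auto simp: ab_hom_def hom_def)

lemma ab_hom_id: "comm_group G \<Longrightarrow> (\<lambda>a\<in>carrier G. a) \<in> ab_hom G G"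
  by (rule ab_homI)
    (auto simp: comm_group_def comm_monoid_def intro: monoid.m_closed)

lemma ab_hom_compose:
  "comm_group G \<Longrightarrow> g \<in> ab_hom G H \<Longrightarrow> h \<in> ab_hom H K \<Longrightarrow> compose (carrier G) h g \<in> ab_hom G K"
  using group.hom_compose by (fastforce simp: ab_hom_def comm_group_def)

lemma abelian_data_comm_group: "abelian_data X F \<Longrightarrow> x \<in> topspace X \<Longrightarrow> comm_group (stalk F x)"
  by (simp add: abelian_data_def)

lemma rmap_ab_hom: "abelian_data X F \<Longrightarrow> sp_le X x y \<Longrightarrow> rmap F x y \<in> ab_hom (stalk F x) (stalk F y)"
  by (simp add: abelian_data_def)

lemma rmap_closed:
  "abelian_data X F \<Longrightarrow> sp_le X x y \<Longrightarrow> a \<in> carrier (stalk F x) \<Longrightarrow> rmap F x y a \<in> carrier (stalk F y)"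
  by (blast intro: rmap_ab_hom ab_hom_closed)

lemma sp_le_topspace: "sp_le X x y \<Longrightarrow> x \<in> topspace X \<and> y \<in> topspace X"
  by (simp add: sp_le_def)

lemma data_homI:
  assumes "\<phi> \<in> extensional (topspace X)"
    and "\<And>x. x \<in> topspace X \<Longrightarrow> \<phi> x \<in> ab_hom (stalk F x) (stalk G x)"
    and "\<And>x y a. \<lbrakk>sp_le X x y; a \<in> carrier (stalk F x)\<rbrakk> \<Longrightarrow> \<phi> y (rmap F x y a) = rmap G x y (\<phi> x a)"
  shows "\<phi> \<in> data_hom X F G"
  using assms by (simp add: data_hom_def)

lemma data_hom_ab_hom: "\<phi> \<in> data_hom X F G \<Longrightarrow> x \<in> topspace X \<Longrightarrow> \<phi> x \<in> ab_hom (stalk F x) (stalk G x)"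
  by (simp add: data_hom_def)

lemma data_hom_closed:
  "\<phi> \<in> data_hom X F G \<Longrightarrow> x \<in> topspace X \<Longrightarrow> a \<in> carrier (stalk F x) \<Longrightarrow> \<phi> x a \<in> carrier (stalk G x)"
  by (blast intro: data_hom_ab_hom ab_hom_closed)

lemma data_hom_rmap:
  "\<phi> \<in> data_hom X F G \<Longrightarrow> sp_le X x y \<Longrightarrow> a \<in> carrier (stalk F x)
   \<Longrightarrow> \<phi> y (rmap F x y a) = rmap G x y (\<phi> x a)"
  by (simp add: data_hom_def)

lemma data_hom_id:
  assumes "abelian_data X F"
  shows "(\<lambda>x\<in>topspace X. \<lambda>a\<in>carrier (stalk F x). a) \<in> data_hom X F F"
  using assms by (intro data_homI)
    (auto simp: ab_hom_id abelian_data_comm_group rmap_closed dest: sp_le_topspace)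

lemma data_hom_compose:
  assumes F: "abelian_data X F" and \<phi>: "\<phi> \<in> data_hom X F G" and \<psi>: "\<psi> \<in> data_hom X G H"
  shows "(\<lambda>x\<in>topspace X. compose (carrier (stalk F x)) (\<psi> x) (\<phi> x)) \<in> data_hom X F H"
proof (rule data_homI)
  fix x assume "x \<in> topspace X"
  then show "(\<lambda>x\<in>topspace X. compose (carrier (stalk F x)) (\<psi> x) (\<phi> x)) x \<in> ab_hom (stalk F x) (stalk H x)"
    using ab_hom_compose[OF abelian_data_comm_group[OF F] data_hom_ab_hom[OF \<phi>] data_hom_ab_hom[OF \<psi>]] by simp
next
  fix x y a assume *: "sp_le X x y" "a \<in> carrier (stalk F x)"
  then have xy: "x \<in> topspace X" "y \<in> topspace X" by (auto dest: sp_le_topspace)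
  show "(\<lambda>x\<in>topspace X. compose (carrier (stalk F x)) (\<psi> x) (\<phi> x)) y (rmap F x y a)
      = rmap H x y ((\<lambda>x\<in>topspace X. compose (carrier (stalk F x)) (\<psi> x) (\<phi> x)) x a)"
    using * xy by (simp add: compose_eq rmap_closed[OF F] data_hom_rmap[OF \<phi>] data_hom_rmap[OF \<psi>]
        data_hom_closed[OF \<phi>])
qed simp

lemma is_complex_abelian_data: "is_complex X A \<Longrightarrow> abelian_data X (deg A n)"
  and is_complex_diff: "is_complex X A \<Longrightarrow> diff A n \<in> data_hom X (deg A n) (deg A (n + 1))"
  by (simp_all add: is_complex_def)

lemma chain_map_data_hom: "chain_map X A B \<phi> \<Longrightarrow> \<phi> n \<in> data_hom X (deg A n) (deg B n)"
  by (simp add: chain_map_def)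

lemma Ob_Ch [simp]: "Ob (Ch X) = {A. is_complex X A}"
  and Src_Ch [simp]: "Src (Ch X) (A, \<phi>, B) = A"
  and Tgt_Ch [simp]: "Tgt (Ch X) (A, \<phi>, B) = B"
  by (simp_all add: Ch_def)

lemma Hom_Ch:
  "h \<in> Hom (Ch X) A B \<longleftrightarrow> (\<exists>\<phi>. h = (A, \<phi>, B) \<and> is_complex X A \<and> is_complex X B \<and> chain_map X A B \<phi>)"
  by (auto simp: Hom_def Ch_def)

lemma Idn_Ch: "Idn (Ch X) A = (A, (\<lambda>n. \<lambda>x\<in>topspace X. \<lambda>a\<in>carrier (stalk (deg A n) x). a), A)"
  by (simp add: Ch_def)

lemma Comp_Ch: "Comp (Ch X) (B', \<psi>, C) (A, \<phi>, B) =
  (A, (\<lambda>n. \<lambda>x\<in>topspace X. compose (carrier (stalk (deg A n) x)) (\<psi> n x) (\<phi> n x)), C)"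
  by (simp add: Ch_def)

lemma is_precategory_Ch: "is_precategory (Ch X)"
  unfolding is_precategory_def
proof (intro conjI ballI)
  fix A :: "('a, 'b) dcomplex" assume "A \<in> Ob (Ch X)"
  then have A: "is_complex X A" by simp
  have "chain_map X A A (\<lambda>n. \<lambda>x\<in>topspace X. \<lambda>a\<in>carrier (stalk (deg A n) x). a)"
    using data_hom_id[OF is_complex_abelian_data[OF A]] data_hom_closed[OF is_complex_diff[OF A]]
    by (simp add: chain_map_def)
  then show "Idn (Ch X) A \<in> Hom (Ch X) A A" using A by (simp add: Idn_Ch Hom_Ch)
next
  fix A B C :: "('a, 'b) dcomplex" and f g
  assume "f \<in> Hom (Ch X) A B" "g \<in> Hom (Ch X) B C"
  then obtain \<phi> \<psi> where A: "is_complex X A" and C: "is_complex X C" and f: "f = (A, \<phi>, B)"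
    and g: "g = (B, \<psi>, C)" and \<phi>: "chain_map X A B \<phi>" and \<psi>: "chain_map X B C \<psi>"
    by (auto simp: Hom_Ch)
  have "chain_map X A C (\<lambda>n. \<lambda>x\<in>topspace X. compose (carrier (stalk (deg A n) x)) (\<psi> n x) (\<phi> n x))"
    unfolding chain_map_def
  proof (intro conjI allI ballI)
    fix n
    show "(\<lambda>x\<in>topspace X. compose (carrier (stalk (deg A n) x)) (\<psi> n x) (\<phi> n x)) \<in> data_hom X (deg A n) (deg C n)"
      using A \<phi> \<psi> by (intro data_hom_compose[of X _ _ "deg B n"] is_complex_abelian_data chain_map_data_hom)
  next
    fix n x a assume x: "x \<in> topspace X" and a: "a \<in> carrier (stalk (deg A n) x)"
    then show "(\<lambda>x\<in>topspace X. compose (carrier (stalk (deg A (n + 1)) x)) (\<psi> (n + 1) x) (\<phi> (n + 1) x)) x (diff A n x a)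
        = diff C n x ((\<lambda>x\<in>topspace X. compose (carrier (stalk (deg A n) x)) (\<psi> n x) (\<phi> n x)) x a)"
      using \<phi> \<psi> data_hom_closed[OF is_complex_diff[OF A] x a]
        data_hom_closed[OF chain_map_data_hom[OF \<phi>] x a]
      by (simp add: compose_eq chain_map_def)
  qed
  then show "Comp (Ch X) g f \<in> Hom (Ch X) A C" using A C by (simp add: f g Comp_Ch Hom_Ch)
qed

lemma quasi_isosI:
  assumes "s \<in> Hom (Ch X) A B"
    and "\<And>n x. x \<in> topspace X \<Longrightarrow> cohomology_map s n x \<in> iso (cohomology A n x) (cohomology B n x)"
  shows "s \<in> quasi_isos X"
  using assms by (auto simp: quasi_isos_def Hom_def)

lemma quasi_isosE:
  assumes "s \<in> quasi_isos X"
  obtains A \<phi> B where "s = (A, \<phi>, B)" "s \<in> Hom (Ch X) A B" "is_complex X A" "is_complex X B"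
    "\<And>n x. x \<in> topspace X \<Longrightarrow> cohomology_map s n x \<in> iso (cohomology A n x) (cohomology B n x)"
proof -
  obtain A \<phi> B where s: "s = (A, \<phi>, B)" by (cases s)
  show thesis
  proof
    show "s = (A, \<phi>, B)" by (fact s)
  qed (use assms in \<open>auto simp: s quasi_isos_def Hom_def Ch_def\<close>)
qed

section \<open>Exact pullback along a continuous map: on data, complexes and derived
  categories\<close>

section \<open>Inverse images\<close>

text \<open>A continuous map sends the closure of q into the closure of f q, so it is monotone for
  the specialisation preorder. This is what gives pulled back data their transition maps.\<close>

lemma sp_le_continuous:
  assumes f: "continuous_map X Y f" and le: "sp_le X p q"
  shows "sp_le Y (f p) (f q)"
proof -
  have pq: "p \<in> topspace X" "q \<in> topspace X" using le by (auto simp: sp_le_def)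
  then have fpq: "f p \<in> topspace Y" "f q \<in> topspace Y"
    using continuous_map_image_subset_topspace[OF f] by auto
  have "p \<in> X closure_of {q}"
    using le closure_of_subset[of "{p}" X] pq by (auto simp: sp_le_def)
  then have "f p \<in> Y closure_of {f q}"
    using continuous_map_image_closure_subset[OF f, of "{q}"] by auto
  then show ?thesis using fpq by (simp add: sp_le_def closure_of_minimal)
qed

context
  fixes X :: "'x topology" and Y :: "'y topology" and f :: "'x \<Rightarrow> 'y"
  assumes cont: "continuous_map X Y f"
begin

lemma f_topspace: "x \<in> topspace X \<Longrightarrow> f x \<in> topspace Y"
  using continuous_map_image_subset_topspace[OF cont] by auto

lemma stalk_inv_image [simp]: "x \<in> topspace X \<Longrightarrow> stalk (inv_image_data X f G) x = stalk G (f x)"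
  and rmap_inv_image [simp]: "sp_le X x y \<Longrightarrow> rmap (inv_image_data X f G) x y = rmap G (f x) (f y)"
  by (simp_all add: inv_image_data_def)

lemma inv_image_complex_simps [simp]:
  "deg (inv_image_complex X f A) n = inv_image_data X f (deg A n)"
  "diff (inv_image_complex X f A) n = (\<lambda>x\<in>topspace X. diff A n (f x))"
  by (simp_all add: inv_image_complex_def)

lemma abelian_data_inv_image:
  assumes G: "abelian_data Y G"
  shows "abelian_data X (inv_image_data X f G)"
  unfolding abelian_data_def
proof (intro conjI allI impI ballI)
  fix x y assume le: "sp_le X x y"
  then show "rmap (inv_image_data X f G) x y
      \<in> ab_hom (stalk (inv_image_data X f G) x) (stalk (inv_image_data X f G) y)"
    using rmap_ab_hom[OF G sp_le_continuous[OF cont le]] sp_le_topspace[OF le] by simp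
next
  fix x a assume x: "x \<in> topspace X" and a: "a \<in> carrier (stalk (inv_image_data X f G) x)"
  then show "rmap (inv_image_data X f G) x x a = a"
    using G f_topspace by (simp add: sp_le_def abelian_data_def)
next
  fix x y z a
  assume le: "sp_le X x y \<and> sp_le X y z" and a: "a \<in> carrier (stalk (inv_image_data X f G) x)"
  then have "sp_le X x z" "x \<in> topspace X" by (auto simp: sp_le_def)
  then show "rmap (inv_image_data X f G) y z (rmap (inv_image_data X f G) x y a)
      = rmap (inv_image_data X f G) x z a"
    using le a G sp_le_continuous[OF cont] by (simp add: abelian_data_def)
next
  fix x assume "x \<in> topspace X"
  then show "comm_group (stalk (inv_image_data X f G) x)"
    using G f_topspace by (simp add: abelian_data_def)
qed (simp_all add: inv_image_data_def)

lemma data_hom_inv_image: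
  assumes \<phi>: "\<phi> \<in> data_hom Y F G"
  shows "(\<lambda>x\<in>topspace X. \<phi> (f x)) \<in> data_hom X (inv_image_data X f F) (inv_image_data X f G)"
proof (rule data_homI)
  fix x y a assume le: "sp_le X x y" and "a \<in> carrier (stalk (inv_image_data X f F) x)"
  then show "(\<lambda>x\<in>topspace X. \<phi> (f x)) y (rmap (inv_image_data X f F) x y a)
      = rmap (inv_image_data X f G) x y ((\<lambda>x\<in>topspace X. \<phi> (f x)) x a)"
    using sp_le_topspace[OF le] data_hom_rmap[OF \<phi> sp_le_continuous[OF cont le]] by simp
qed (use data_hom_ab_hom[OF \<phi>] f_topspace in simp_all)

lemma is_complex_inv_image: "is_complex Y A \<Longrightarrow> is_complex X (inv_image_complex X f A)"
  using f_topspace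
  by (simp add: is_complex_def abelian_data_inv_image data_hom_inv_image)

lemma chain_map_inv_image:
  "chain_map Y A B \<phi> \<Longrightarrow>
   chain_map X (inv_image_complex X f A) (inv_image_complex X f B) (\<lambda>n. \<lambda>x\<in>topspace X. \<phi> n (f x))"
  using f_topspace by (simp add: chain_map_def data_hom_inv_image)

lemma onOb_inv_image_Ch [simp]: "onOb (inv_image_Ch X f) A = inv_image_complex X f A"
  and onArr_inv_image_Ch [simp]: "onArr (inv_image_Ch X f) (A, \<phi>, B) =
    (inv_image_complex X f A, (\<lambda>n. \<lambda>x\<in>topspace X. \<phi> n (f x)), inv_image_complex X f B)"
  by (simp_all add: inv_image_Ch_def)

lemma is_functor_inv_image_Ch:
  "is_functor (Ch Y) (Ch X)
    (inv_image_Ch X f :: (('y, 'u) dcomplex, ('y, 'u) ch_arr, ('x, 'u) dcomplex, ('x, 'u) ch_arr) cfunctor)"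
  unfolding is_functor_def
proof (intro conjI ballI)
  fix A :: "('y, 'u) dcomplex" assume "A \<in> Ob (Ch Y)"
  then show "onOb (inv_image_Ch X f) A \<in> Ob (Ch X)" by (simp add: is_complex_inv_image)
  show "onArr (inv_image_Ch X f) (Idn (Ch Y) A) = Idn (Ch X) (onOb (inv_image_Ch X f) A)"
    using f_topspace by (auto simp: Idn_Ch fun_eq_iff restrict_def)
next
  fix A B :: "('y, 'u) dcomplex" and h assume "h \<in> Hom (Ch Y) A B"
  then show "onArr (inv_image_Ch X f) h \<in> Hom (Ch X) (onOb (inv_image_Ch X f) A) (onOb (inv_image_Ch X f) B)"
    by (auto simp: Hom_Ch is_complex_inv_image chain_map_inv_image)
next
  fix A B C :: "('y, 'u) dcomplex" and h k assume "h \<in> Hom (Ch Y) A B" "k \<in> Hom (Ch Y) B C"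
  then show "onArr (inv_image_Ch X f) (Comp (Ch Y) k h)
      = Comp (Ch X) (onArr (inv_image_Ch X f) k) (onArr (inv_image_Ch X f) h)"
    using f_topspace by (auto simp: Hom_Ch Comp_Ch fun_eq_iff restrict_def)
qed

text \<open>Cohomology is computed stalkwise, and the stalk of the pullback at x is the stalk at f
  x; an isomorphism at f x is therefore literally one at x. This is the exactness that lets pullback
  descend to derived categories.\<close>

lemma inv_image_Ch_quasi_isos: "onArr (inv_image_Ch X f) ` quasi_isos Y \<subseteq> quasi_isos X"
proof (rule image_subsetI)
  fix s assume "s \<in> quasi_isos Y"
  then obtain A \<phi> B where s: "s = (A, \<phi>, B)" "s \<in> Hom (Ch Y) A B" "is_complex Y A" "is_complex Y B"
    and iso: "\<And>n y. y \<in> topspace Y \<Longrightarrow> cohomology_map s n y \<in> iso (cohomology A n y) (cohomology B n y)"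
    by (elim quasi_isosE) blast
  have "cohomology (inv_image_complex X f A) n x = cohomology A n (f x)"
    if "x \<in> topspace X" for A :: "('y, 'b) dcomplex" and n x
    using that by (simp add: cohomology_def coboundaries_def)
  moreover have "cohomology_map (onArr (inv_image_Ch X f) s) n x = cohomology_map s n (f x)"
    if "x \<in> topspace X" for n x
    using that by (simp add: s cohomology_map_def coboundaries_def)
  ultimately show "onArr (inv_image_Ch X f) s \<in> quasi_isos X"
    using iso f_topspace functor_Hom[OF is_functor_inv_image_Ch _ _ s(2)] s(3,4)
    by (intro quasi_isosI[where A = "inv_image_complex X f A" and B = "inv_image_complex X f B"]) auto
qed

lemma is_functor_inv_image_D: "is_functor (Der Y) (Der X) (inv_image_D X f)"
  unfolding Der_def inv_image_D_def
  by (intro is_functor_induced is_precategory_Ch is_functor_inv_image_Ch inv_image_Ch_quasi_isos)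

end

section \<open>Direct image along a closed inclusion: extension by zero, its exactness and its
  unit\<close>

section \<open>Extension by zero from a closed subset\<close>

text \<open>The zero group must be carried by a subset of the universe \<open>'u\<close>, and
  \<open>undefined\<close> is an element available in every type. With this choice zero maps
  coincide with the default value of \<open>restrict\<close>: they are constantly
  \<open>undefined\<close>.\<close>

definition trivial_group :: "'u monoid" where
  "trivial_group = \<lparr>carrier = {undefined}, mult = (\<lambda>_ _. undefined), one = undefined\<rparr>"

lemma trivial_group_simps [simp]:
  "carrier trivial_group = {undefined}" "a \<otimes>\<^bsub>trivial_group\<^esub> b = undefined" "\<one>\<^bsub>trivial_group\<^esub> = undefined"
  by (simp_all add: trivial_group_def)

lemma comm_group_trivial_group: "comm_group trivial_group"
  by (rule comm_groupI) auto

text \<open>For closed \<open>U\<close> this is the right Kan extension along the inclusion: no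
  point outside \<open>U\<close> lies below a point of \<open>U\<close>, so the limit at such a
  point is over the empty set. For the same reason a transition map into \<open>U\<close> starts in
  \<open>U\<close>, which makes \<open>rmap G x y\<close> meaningful whenever y is in
  \<open>U\<close>.\<close>

definition ext_data :: "'x topology \<Rightarrow> 'x set \<Rightarrow> ('x, 'u) data \<Rightarrow> ('x, 'u) data" where
  "ext_data X U G =
     \<lparr>stalk = (\<lambda>x\<in>topspace X. if x \<in> U then stalk G x else trivial_group),
      rmap = (\<lambda>x y. if sp_le X x y then
        if y \<in> U then rmap G x y
        else (\<lambda>a\<in>carrier (if x \<in> U then stalk G x else trivial_group). undefined)
        else undefined)\<rparr>"

definition ext_map :: "'x topology \<Rightarrow> 'x set \<Rightarrow> ('x \<Rightarrow> 'u \<Rightarrow> 'u) \<Rightarrow> 'x \<Rightarrow> 'u \<Rightarrow> 'u" where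
  "ext_map X U \<phi> = (\<lambda>x\<in>topspace X. if x \<in> U then \<phi> x else (\<lambda>a\<in>{undefined}. undefined))"

definition ext_complex :: "'x topology \<Rightarrow> 'x set \<Rightarrow> ('x, 'u) dcomplex \<Rightarrow> ('x, 'u) dcomplex" where
  "ext_complex X U A = \<lparr>deg = (\<lambda>n. ext_data X U (deg A n)), diff = (\<lambda>n. ext_map X U (diff A n))\<rparr>"

definition ext_Ch ::
  "'x topology \<Rightarrow> 'x set \<Rightarrow>
   (('x, 'u) dcomplex, ('x, 'u) ch_arr, ('x, 'u) dcomplex, ('x, 'u) ch_arr) cfunctor" where
  "ext_Ch X U =
     \<lparr>onOb = ext_complex X U,
      onArr = (\<lambda>(A, \<phi>, B). (ext_complex X U A, (\<lambda>n. ext_map X U (\<phi> n)), ext_complex X U B))\<rparr>"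

text \<open>The unit of the adjunction between restriction and extension by zero. Off
  \<open>U\<close> the value \<open>undefined\<close> is the zero element of
  \<open>trivial_group\<close>.\<close>

definition ext_unit :: "'x topology \<Rightarrow> 'x set \<Rightarrow> ('x, 'u) dcomplex \<Rightarrow> ('x, 'u) ch_arr" where
  "ext_unit X U A =
     (A, (\<lambda>n. \<lambda>x\<in>topspace X. \<lambda>a\<in>carrier (stalk (deg A n) x). if x \<in> U then a else undefined),
      ext_complex X U (onOb (restrict_Ch X U) A))"

context
  fixes X :: "'x topology" and U :: "'x set"
  assumes closed: "closedin X U"
begin

lemma U_topspace: "U \<subseteq> topspace X"
  using closed by (rule closedin_subset)

lemma topspace_U: "topspace (subtopology X U) = U"
  using U_topspace by auto

lemma Int_U [simp]: "topspace X \<inter> U = U"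
  using U_topspace by auto

lemma sp_le_U: "sp_le (subtopology X U) x y \<longleftrightarrow> x \<in> U \<and> y \<in> U \<and> sp_le X x y"
  by (rule sp_le_subtopology[OF U_topspace])

text \<open>x lies in the closure of y, which a closed set containing y must contain: closed sets
  are down-sets of the preorder. All case distinctions about extension by zero rest on this.\<close>

lemma sp_le_closed: "sp_le X x y \<Longrightarrow> y \<in> U \<Longrightarrow> x \<in> U"
  using closure_of_minimal[OF _ closed, of "{y}"] closure_of_subset[of "{x}" X]
  by (auto simp: sp_le_def)

lemma continuous_U: "continuous_map (subtopology X U) X (\<lambda>x. x)"
  using continuous_map_id_subt[of X U] by (simp add: id_def)

lemma stalk_ext [simp]:
    "x \<in> U \<Longrightarrow> stalk (ext_data X U G) x = stalk G x"
    "x \<in> topspace X \<Longrightarrow> x \<notin> U \<Longrightarrow> stalk (ext_data X U G) x = trivial_group"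
  and rmap_ext [simp]:
    "sp_le X x y \<Longrightarrow> y \<in> U \<Longrightarrow> rmap (ext_data X U G) x y = rmap G x y"
    "sp_le X x y \<Longrightarrow> y \<notin> U \<Longrightarrow>
     rmap (ext_data X U G) x y = (\<lambda>a\<in>carrier (stalk (ext_data X U G) x). undefined)"
  using U_topspace by (auto simp: ext_data_def dest: sp_le_topspace)

lemma ext_map_simps [simp]:
  "x \<in> U \<Longrightarrow> ext_map X U \<phi> x = \<phi> x"
  "x \<in> topspace X \<Longrightarrow> x \<notin> U \<Longrightarrow> ext_map X U \<phi> x = (\<lambda>a\<in>{undefined}. undefined)"
  using U_topspace by (auto simp: ext_map_def)

lemma ext_complex_simps [simp]:
  "deg (ext_complex X U A) n = ext_data X U (deg A n)"
  "diff (ext_complex X U A) n = ext_map X U (diff A n)"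
  by (simp_all add: ext_complex_def)

lemma zero_ab_hom: "(\<lambda>a\<in>carrier G. undefined) \<in> ab_hom G trivial_group" if "comm_group G" for G :: "'u monoid"
  using that by (intro ab_homI) (auto simp: comm_group_def comm_monoid_def intro: monoid.m_closed)

lemma comm_group_ext:
  assumes G: "abelian_data (subtopology X U) G" and x: "x \<in> topspace X"
  shows "comm_group (stalk (ext_data X U G) x)"
  using abelian_data_comm_group[OF G] x comm_group_trivial_group
  by (cases "x \<in> U") (simp_all add: topspace_U)

text \<open>Transition maps compose because a chain ending in \<open>U\<close> lies entirely in
  \<open>U\<close>, where G is functorial, while a chain ending outside \<open>U\<close> lands in
  the zero group.\<close>

lemma abelian_data_ext:
  assumes G: "abelian_data (subtopology X U) G"
  shows "abelian_data X (ext_data X U G)"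
proof -
  have hom: "rmap (ext_data X U G) x y \<in> ab_hom (stalk (ext_data X U G) x) (stalk (ext_data X U G) y)"
    if le: "sp_le X x y" for x y
  proof (cases "y \<in> U")
    case True
    then show ?thesis using le rmap_ab_hom[OF G, of x y] sp_le_closed[OF le] by (simp add: sp_le_U)
  next
    case False
    then show ?thesis using le sp_le_topspace[OF le] zero_ab_hom[OF comm_group_ext[OF G]] by simp
  qed
  show ?thesis
    unfolding abelian_data_def
  proof (intro conjI allI impI ballI)
    fix x a assume x: "x \<in> topspace X" and a: "a \<in> carrier (stalk (ext_data X U G) x)"
    have le: "sp_le X x x" using x by (simp add: sp_le_def)
    show "rmap (ext_data X U G) x x a = a"
      using G x a le by (cases "x \<in> U") (simp_all add: abelian_data_def topspace_U)
  next
    fix x y z a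
    assume le: "sp_le X x y \<and> sp_le X y z" and a: "a \<in> carrier (stalk (ext_data X U G) x)"
    then have xz: "sp_le X x z" by (auto simp: sp_le_def)
    have c: "rmap (ext_data X U G) x y a \<in> carrier (stalk (ext_data X U G) y)"
      using hom[of x y] le a by (blast intro: ab_hom_closed)
    show "rmap (ext_data X U G) y z (rmap (ext_data X U G) x y a) = rmap (ext_data X U G) x z a"
    proof (cases "z \<in> U")
      case True
      then have "x \<in> U" "y \<in> U" using le sp_le_closed by blast+
      moreover have "sp_le (subtopology X U) x y" "sp_le (subtopology X U) y z"
        using le True calculation by (simp_all add: sp_le_U)
      ultimately show ?thesis using G le True a xz unfolding abelian_data_def by simp
    next
      case False
      then show ?thesis using le xz a c by simp
    qed
  next
    fix x y assume "sp_le X x y"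
    then show "rmap (ext_data X U G) x y \<in> ab_hom (stalk (ext_data X U G) x) (stalk (ext_data X U G) y)"
      by (rule hom)
  next
    fix x assume "x \<in> topspace X"
    then show "comm_group (stalk (ext_data X U G) x)" by (rule comm_group_ext[OF G])
  qed (simp_all add: ext_data_def)
qed

lemma data_hom_ext:
  assumes \<phi>: "\<phi> \<in> data_hom (subtopology X U) F G"
  shows "ext_map X U \<phi> \<in> data_hom X (ext_data X U F) (ext_data X U G)"
proof (rule data_homI)
  show "ext_map X U \<phi> \<in> extensional (topspace X)" by (simp add: ext_map_def)
next
  fix x assume "x \<in> topspace X"
  then show "ext_map X U \<phi> x \<in> ab_hom (stalk (ext_data X U F) x) (stalk (ext_data X U G) x)"
    using data_hom_ab_hom[OF \<phi>, of x] zero_ab_hom[OF comm_group_trivial_group]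
    by (cases "x \<in> U") (simp_all add: topspace_U)
next
  fix x y a assume le: "sp_le X x y" and a: "a \<in> carrier (stalk (ext_data X U F) x)"
  note xy = sp_le_topspace[OF le]
  show "ext_map X U \<phi> y (rmap (ext_data X U F) x y a) = rmap (ext_data X U G) x y (ext_map X U \<phi> x a)"
  proof (cases "y \<in> U")
    case True
    then show ?thesis using le a sp_le_closed[OF le] data_hom_rmap[OF \<phi>, of x y a] by (simp add: sp_le_U)
  next
    case False
    then show ?thesis using le a xy data_hom_closed[OF \<phi>, of x a] by (cases "x \<in> U") (simp_all add: topspace_U)
  qed
qed

lemma is_complex_ext: "is_complex (subtopology X U) A \<Longrightarrow> is_complex X (ext_complex X U A)"
proof -
  assume A: "is_complex (subtopology X U) A"
  have "diff (ext_complex X U A) (n + 1) x (diff (ext_complex X U A) n x a)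
      = \<one>\<^bsub>stalk (deg (ext_complex X U A) (n + 2)) x\<^esub>"
    if "x \<in> topspace X" "a \<in> carrier (stalk (deg (ext_complex X U A) n) x)" for n x a
    using that A by (cases "x \<in> U") (simp_all add: is_complex_def topspace_U)
  then show ?thesis
    using A unfolding is_complex_def ext_complex_simps by (blast intro: abelian_data_ext data_hom_ext)
qed

lemma chain_map_ext:
  assumes "chain_map (subtopology X U) A B \<phi>"
  shows "chain_map X (ext_complex X U A) (ext_complex X U B) (\<lambda>n. ext_map X U (\<phi> n))"
proof -
  have "ext_map X U (\<phi> (n + 1)) x (diff (ext_complex X U A) n x a)
      = diff (ext_complex X U B) n x (ext_map X U (\<phi> n) x a)"
    if "x \<in> topspace X" "a \<in> carrier (stalk (deg (ext_complex X U A) n) x)" for n x a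
    using that assms by (cases "x \<in> U") (simp_all add: chain_map_def topspace_U)
  then show ?thesis
    using assms unfolding chain_map_def ext_complex_simps by (blast intro: data_hom_ext)
qed

lemma onOb_ext_Ch [simp]: "onOb (ext_Ch X U) A = ext_complex X U A"
  and onArr_ext_Ch [simp]: "onArr (ext_Ch X U) (A, \<phi>, B) =
    (ext_complex X U A, (\<lambda>n. ext_map X U (\<phi> n)), ext_complex X U B)"
  by (simp_all add: ext_Ch_def)

lemma is_functor_ext_Ch:
  "is_functor (Ch (subtopology X U)) (Ch X)
    (ext_Ch X U :: (('x, 'u) dcomplex, ('x, 'u) ch_arr, ('x, 'u) dcomplex, ('x, 'u) ch_arr) cfunctor)"
  unfolding is_functor_def
proof (intro conjI ballI)
  fix A :: "('x, 'u) dcomplex" assume "A \<in> Ob (Ch (subtopology X U))"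
  then show "onOb (ext_Ch X U) A \<in> Ob (Ch X)" by (simp add: is_complex_ext)
  have "ext_map X U (\<lambda>x\<in>U. \<lambda>a\<in>carrier (stalk (deg A n) x). a)
      = (\<lambda>x\<in>topspace X. \<lambda>a\<in>carrier (stalk (ext_data X U (deg A n)) x). a)" for n
    using U_topspace by (auto simp: fun_eq_iff ext_map_def)
  then show "onArr (ext_Ch X U) (Idn (Ch (subtopology X U)) A) = Idn (Ch X) (onOb (ext_Ch X U) A)"
    by (simp add: Idn_Ch topspace_U)
next
  fix A B :: "('x, 'u) dcomplex" and h assume "h \<in> Hom (Ch (subtopology X U)) A B"
  then show "onArr (ext_Ch X U) h \<in> Hom (Ch X) (onOb (ext_Ch X U) A) (onOb (ext_Ch X U) B)"
    by (auto simp: Hom_Ch is_complex_ext chain_map_ext)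
next
  fix A B C :: "('x, 'u) dcomplex" and h k
  assume "h \<in> Hom (Ch (subtopology X U)) A B" "k \<in> Hom (Ch (subtopology X U)) B C"
  moreover have "ext_map X U (\<lambda>x\<in>U. compose (carrier (stalk (deg A n) x)) (\<psi> x) (\<phi> x))
      = (\<lambda>x\<in>topspace X. compose (carrier (stalk (ext_data X U (deg A n)) x)) (ext_map X U \<psi> x) (ext_map X U \<phi> x))"
    for \<phi> \<psi> n
    using U_topspace by (auto simp: fun_eq_iff ext_map_def compose_def)
  ultimately show "onArr (ext_Ch X U) (Comp (Ch (subtopology X U)) k h)
      = Comp (Ch X) (onArr (ext_Ch X U) k) (onArr (ext_Ch X U) h)"
    by (auto simp: Hom_Ch Comp_Ch topspace_U)
qed

text \<open>Exactness of extension by zero, stalk by stalk: over \<open>U\<close> the cohomology and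
  the map on it are unchanged, and elsewhere both cohomology groups are the same one-element
  group.\<close>

lemma ext_Ch_quasi_isos: "onArr (ext_Ch X U) ` quasi_isos (subtopology X U) \<subseteq> quasi_isos X"
proof (rule image_subsetI)
  fix s :: "('x, 'u) ch_arr" assume "s \<in> quasi_isos (subtopology X U)"
  then obtain A \<phi> B where s: "s = (A, \<phi>, B)" "s \<in> Hom (Ch (subtopology X U)) A B"
      "is_complex (subtopology X U) A" "is_complex (subtopology X U) B"
    and iso: "\<And>n x. x \<in> topspace (subtopology X U) \<Longrightarrow>
      cohomology_map s n x \<in> iso (cohomology A n x) (cohomology B n x)"
    by (elim quasi_isosE) blast
  \<comment> \<open>Off \<open>U\<close> the kernel and the coboundaries are both the singleton of
    \<open>undefined\<close>. The carrier update is kept because this is the form to which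
    \<open>cohomology_def\<close> unfolds.\<close>
  let ?T = "(trivial_group\<lparr>carrier := {undefined}\<rparr> :: 'u monoid) Mod {undefined}"
  have T: "carrier ?T = {{undefined}}" "\<And>P Q. P \<otimes>\<^bsub>?T\<^esub> Q = P <#>\<^bsub>trivial_group\<^esub> Q"
    by (auto simp: FactGroup_def RCOSETS_def r_coset_def set_mult_def)
  have in_U: "cohomology (ext_complex X U A) n x = cohomology A n x"
    if "x \<in> U" for A :: "('x, 'u) dcomplex" and n x
    using that by (simp add: cohomology_def coboundaries_def)
  have out_U: "cohomology (ext_complex X U A) n x = ?T"
    if "x \<in> topspace X" "x \<notin> U" for A :: "('x, 'u) dcomplex" and n x
    using that by (simp add: cohomology_def coboundaries_def kernel_def)
  have "cohomology_map (onArr (ext_Ch X U) s) n x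
      \<in> iso (cohomology (ext_complex X U A) n x) (cohomology (ext_complex X U B) n x)"
    if x: "x \<in> topspace X" for n x
  proof (cases "x \<in> U")
    case True
    then have "cohomology_map (onArr (ext_Ch X U) s) n x = cohomology_map s n x"
      by (simp add: s cohomology_map_def coboundaries_def)
    then show ?thesis using iso[of x n] True U_topspace by (auto simp: in_U)
  next
    case False
    then have "cohomology_map (onArr (ext_Ch X U) s) n x {undefined} = {undefined}"
      using x by (simp add: s cohomology_map_def coboundaries_def set_mult_def)
    moreover have "{undefined} <#>\<^bsub>trivial_group\<^esub> {undefined} = {undefined :: 'u}"
      by (simp add: set_mult_def)
    ultimately show ?thesis
      unfolding out_U[OF x False] iso_def hom_def bij_betw_def by (simp add: T)
  qed
  then show "onArr (ext_Ch X U) s \<in> quasi_isos X"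
    using functor_Hom[OF is_functor_ext_Ch _ _ s(2)] s(3,4)
    by (intro quasi_isosI[where A = "ext_complex X U A" and B = "ext_complex X U B"]) auto
qed

text \<open>Equality on the nose, not merely an isomorphism: abelian data are
  \<open>undefined\<close> off their space and off the preorder, so no trace of the extension
  survives. The reflector argument relies on this strictness in \<open>RE_Ob\<close> and
  \<open>RE_Arr\<close>.\<close>

lemma restrict_ext_data:
  assumes "abelian_data (subtopology X U) G"
  shows "restrict_data X U (ext_data X U G) = G"
proof -
  have "stalk (restrict_data X U (ext_data X U G)) x = stalk G x" for x
    using assms by (cases "x \<in> U") (auto simp: inv_image_data_def abelian_data_def topspace_U extensional_def)
  moreover have "rmap (restrict_data X U (ext_data X U G)) x y = rmap G x y" for x y
    using assms by (auto simp: inv_image_data_def abelian_data_def sp_le_U)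
  ultimately show ?thesis by (intro data.equality) (auto simp: fun_eq_iff)
qed

lemma restrict_ext_map:
  assumes "\<phi> \<in> extensional U"
  shows "(\<lambda>x\<in>U. ext_map X U \<phi> x) = \<phi>"
  using assms by (auto simp: fun_eq_iff extensional_def)

lemma restrict_ext_complex:
  assumes "is_complex (subtopology X U) A"
  shows "inv_image_complex (subtopology X U) (\<lambda>x. x) (ext_complex X U A) = A"
  using assms
  by (intro dcomplex.equality)
    (auto simp: fun_eq_iff[of _ "deg A"] fun_eq_iff[of _ "diff A"] topspace_U is_complex_def data_hom_def
      inv_image_complex_simps[OF continuous_U] restrict_ext_data restrict_ext_map)

lemma restrict_ext_Ch:
  assumes "g \<in> Hom (Ch (subtopology X U)) A B"
  shows "onArr (restrict_Ch X U) (onArr (ext_Ch X U) g) = g"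
proof -
  obtain \<phi> where "g = (A, \<phi>, B)" "is_complex (subtopology X U) A" "is_complex (subtopology X U) B"
      "chain_map (subtopology X U) A B \<phi>"
    using assms by (auto simp: Hom_Ch)
  then show ?thesis
    by (auto simp: onArr_inv_image_Ch[OF continuous_U] restrict_ext_complex topspace_U restrict_ext_map
        chain_map_def data_hom_def fun_eq_iff[of _ \<phi>])
qed

text \<open>Compatibility with transition maps splits by the larger point y: if y is in
  \<open>U\<close>, so is x, and the unit is the identity at both; otherwise the target at y is
  zero.\<close>

lemma ext_unit_Hom:
  assumes A: "is_complex X A"
  shows "ext_unit X U A \<in> Hom (Ch X) A (ext_complex X U (onOb (restrict_Ch X U) A))"
proof -
  let ?R = "inv_image_complex (subtopology X U) (\<lambda>x. x) A"
  let ?u = "\<lambda>n. \<lambda>x\<in>topspace X. \<lambda>a\<in>carrier (stalk (deg A n) x). if x \<in> U then a else undefined"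
  have R: "is_complex (subtopology X U) ?R" by (rule is_complex_inv_image[OF continuous_U A])
  have st: "stalk (deg ?R n) x = stalk (deg A n) x" if "x \<in> U" for n x
    using that by (simp add: inv_image_complex_simps[OF continuous_U] stalk_inv_image[OF continuous_U] topspace_U)
  have "chain_map X A (ext_complex X U ?R) ?u"
    unfolding chain_map_def
  proof (intro conjI allI ballI)
    fix n
    note An = is_complex_abelian_data[OF A, of n]
    show "?u n \<in> data_hom X (deg A n) (deg (ext_complex X U ?R) n)"
    proof (rule data_homI)
      fix x assume x: "x \<in> topspace X"
      show "?u n x \<in> ab_hom (stalk (deg A n) x) (stalk (deg (ext_complex X U ?R) n) x)"
        using x ab_hom_id[OF abelian_data_comm_group[OF An x]] zero_ab_hom[OF abelian_data_comm_group[OF An x]]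
        by (cases "x \<in> U") (simp_all add: st)
    next
      fix x y a assume le: "sp_le X x y" and a: "a \<in> carrier (stalk (deg A n) x)"
      note xy = sp_le_topspace[OF le]
      have ya: "rmap (deg A n) x y a \<in> carrier (stalk (deg A n) y)" by (rule rmap_closed[OF An le a])
      show "?u n y (rmap (deg A n) x y a) = rmap (deg (ext_complex X U ?R) n) x y (?u n x a)"
      proof (cases "y \<in> U")
        case True
        then show ?thesis using sp_le_closed[OF le] le a ya xy
          by (simp add: inv_image_complex_simps[OF continuous_U] rmap_inv_image[OF continuous_U] sp_le_U)
      next
        case False
        then show ?thesis using le a ya xy by (cases "x \<in> U") (simp_all add: st)
      qed
    qed simp
  next
    fix n x a assume x: "x \<in> topspace X" and a: "a \<in> carrier (stalk (deg A n) x)"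
    then show "?u (n + 1) x (diff A n x a) = diff (ext_complex X U ?R) n x (?u n x a)"
      using data_hom_closed[OF is_complex_diff[OF A] x a]
      by (cases "x \<in> U") (simp_all add: inv_image_complex_simps[OF continuous_U] topspace_U)
  qed
  then show ?thesis
    using A is_complex_ext[OF R] by (simp add: ext_unit_def Hom_Ch onOb_inv_image_Ch[OF continuous_U])
qed

text \<open>A triangle identity of the adjunction in strict form: over \<open>U\<close> the unit
  does nothing, and restricting its target gives back the restricted complex itself.\<close>

lemma restrict_ext_unit:
  assumes "is_complex X A"
  shows "onArr (restrict_Ch X U) (ext_unit X U A) = Idn (Ch (subtopology X U)) (onOb (restrict_Ch X U) A)"
  using U_topspace is_complex_inv_image[OF continuous_U assms]
  by (auto simp: ext_unit_def Idn_Ch onArr_inv_image_Ch[OF continuous_U] onOb_inv_image_Ch[OF continuous_U]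
      restrict_ext_complex topspace_U fun_eq_iff inv_image_complex_simps[OF continuous_U]
      stalk_inv_image[OF continuous_U])

text \<open>Over \<open>U\<close> both composites are the given map; elsewhere both are
  zero.\<close>

lemma ext_unit_natural:
  assumes f: "f \<in> Hom (Ch X) A B"
  shows "Comp (Ch X) (ext_unit X U B) f
    = Comp (Ch X) (onArr (ext_Ch X U) (onArr (restrict_Ch X U) f)) (ext_unit X U A)"
proof -
  obtain \<phi> where f: "f = (A, \<phi>, B)" and \<phi>: "chain_map X A B \<phi>" using f by (auto simp: Hom_Ch)
  have "compose (carrier (stalk (deg A n) x)) (\<lambda>a\<in>carrier (stalk (deg B n) x). if x \<in> U then a else undefined) (\<phi> n x)
      = compose (carrier (stalk (deg A n) x)) (ext_map X U (\<lambda>x\<in>U. \<phi> n x) x)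
          (\<lambda>a\<in>carrier (stalk (deg A n) x). if x \<in> U then a else undefined)"
    if x: "x \<in> topspace X" for n x
    using x data_hom_closed[OF chain_map_data_hom[OF \<phi>] x] by (auto simp: fun_eq_iff compose_def)
  then show ?thesis
    by (auto simp: f ext_unit_def Comp_Ch onArr_inv_image_Ch[OF continuous_U] onOb_inv_image_Ch[OF continuous_U]
        topspace_U cong: restrict_cong)
qed

end

section \<open>The base change transformation for derived f_! and the mate it induces\<close>

section \<open>Base change\<close>

text \<open>The arrow half of \<open>shriek_Ch_restrict\<close>. It holds for an arbitrary triple h,
  because both sides evaluate the same chosen colimits over the same fibres.\<close>

lemma shriek_Ch_restrict_Arr:
  assumes C: "closedin Y C" and U: "U = {x \<in> topspace X. f x \<in> C}"
  shows "onArr (restrict_Ch Y C) (onArr (shriek_Ch X Y f) h)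
    = onArr (shriek_Ch (subtopology X U) (subtopology Y C) f) (onArr (restrict_Ch X U) h)"
proof -
  obtain A \<phi> B where h: "h = (A, \<phi>, B)" by (cases h)
  have top: "topspace Y \<inter> C = C" "topspace X \<inter> U = U" using C U closedin_subset by auto
  show ?thesis
    using shriek_Ch_restrict[OF C U, of A] shriek_Ch_restrict[OF C U, of B]
    by (simp add: shriek_map_restrict[OF C U] h inv_image_Ch_def shriek_Ch_def top inv_image_complex_def)
qed

text \<open>That \<open>f\<^sub>! \<phi>\<close> is a chain map is read off from the naturality of \<open>\<epsilon>\<close>, by
  \<open>Hom_if_Comp_loc_functor\<close>, instead of from the existence of the colimits.\<close>

lemma restrict_derived_shriek_nat_trans:
  assumes C: "closedin Y C" and U: "U = {x \<in> topspace X. f x \<in> C}"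
    and fL: "is_functor (Der X) (Der Y) (L :: ('x, 'y, 'u) d_functor)"
    and n\<epsilon>: "nat_trans (Ch X) (Der Y) (L \<cdot>\<^sub>F loc_functor (Ch X) (quasi_isos X))
      (loc_functor (Ch Y) (quasi_isos Y) \<cdot>\<^sub>F shriek_Ch X Y f) \<epsilon>"
  shows "nat_trans (Ch X) (Der (subtopology Y C))
    ((restrict_D Y C \<cdot>\<^sub>F L) \<cdot>\<^sub>F loc_functor (Ch X) (quasi_isos X))
    (loc_functor (Ch (subtopology Y C)) (quasi_isos (subtopology Y C))
      \<cdot>\<^sub>F shriek_Ch (subtopology X U) (subtopology Y C) f \<cdot>\<^sub>F restrict_Ch X U)
    (\<lambda>A\<in>Ob (Ch X). onArr (restrict_D Y C) (\<epsilon> A))"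
proof (rule nat_transI)
  let ?YC = "subtopology Y C"
  let ?QX = "loc_functor (Ch X) (quasi_isos X)" and ?QY = "loc_functor (Ch Y) (quasi_isos Y)"
    and ?QC = "loc_functor (Ch ?YC) (quasi_isos ?YC)"
  note cont = continuous_U[OF C]
  have fD: "is_functor (Der Y) (Der ?YC) (restrict_D Y C)" by (rule is_functor_inv_image_D[OF cont])
  have DerOb: "Ob (Der X) = Ob (Ch X)" for X :: "'z topology" by (simp add: Der_def)
  have LO: "onOb L A \<in> Ob (Der Y)" if "A \<in> Ob (Ch X)" for A
    using functor_Ob[OF fL] that DerOb by metis
  have \<epsilon>H: "\<epsilon> A \<in> Hom (Der Y) (onOb L A) (onOb (shriek_Ch X Y f) A)" if "A \<in> Ob (Ch X)" for A
    using nat_trans_Hom[OF n\<epsilon> that] by simp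
  \<comment> \<open>That f_! A is a complex is again read off from \<epsilon>: it is the end of a
    zigzag.\<close>
  have SO: "onOb (shriek_Ch X Y f) A \<in> Ob (Ch Y)" if "A \<in> Ob (Ch X)" for A :: "('x, 'u) dcomplex"
    using \<epsilon>H[OF that] zigzag_Ob by (force simp: Der_def Hom_localization)
  have obD: "onOb (restrict_D Y C) A = onOb (restrict_Ch Y C) A" for A
    by (simp add: inv_image_D_def)
  have obS: "onOb (restrict_Ch Y C) (onOb (shriek_Ch X Y f) A)
      = onOb (shriek_Ch (subtopology X U) ?YC f) (onOb (restrict_Ch X U) A)" for A
    using shriek_Ch_restrict[OF C U, of A] by simp
  show "(\<lambda>A\<in>Ob (Ch X). onArr (restrict_D Y C) (\<epsilon> A)) A
      \<in> Hom (Der ?YC) (onOb ((restrict_D Y C \<cdot>\<^sub>F L) \<cdot>\<^sub>F ?QX) A)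
          (onOb (?QC \<cdot>\<^sub>F shriek_Ch (subtopology X U) ?YC f \<cdot>\<^sub>F restrict_Ch X U) A)"
    if A: "A \<in> Ob (Ch X)" for A
    using functor_Hom[OF fD LO[OF A] _ \<epsilon>H[OF A]] SO[OF A] A obS[of A] by (simp add: DerOb obD)
  show "Comp (Der ?YC) ((\<lambda>A\<in>Ob (Ch X). onArr (restrict_D Y C) (\<epsilon> A)) B)
        (onArr ((restrict_D Y C \<cdot>\<^sub>F L) \<cdot>\<^sub>F ?QX) h)
      = Comp (Der ?YC)
        (onArr (?QC \<cdot>\<^sub>F shriek_Ch (subtopology X U) ?YC f \<cdot>\<^sub>F restrict_Ch X U) h)
        ((\<lambda>A\<in>Ob (Ch X). onArr (restrict_D Y C) (\<epsilon> A)) A)"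
    if A: "A \<in> Ob (Ch X)" and B: "B \<in> Ob (Ch X)" and h: "h \<in> Hom (Ch X) A B" for A B h
  proof -
    let ?Sh = "onArr (shriek_Ch X Y f) h"
    have pcDY: "is_precategory (Der Y)"
      unfolding Der_def by (intro is_category_imp_precategory is_category_localization is_precategory_Ch)
    have Qh: "onArr ?QX h \<in> Hom (Der X) A B"
      using functor_Hom[OF is_functor_loc_functor[OF is_precategory_Ch] A B h] by (simp add: Der_def)
    have LQh: "onArr L (onArr ?QX h) \<in> Hom (Der Y) (onOb L A) (onOb L B)"
      using functor_Hom[OF fL _ _ Qh] A B by (simp add: DerOb)
    have nat: "Comp (Der Y) (\<epsilon> B) (onArr L (onArr ?QX h)) = Comp (Der Y) (onArr ?QY ?Sh) (\<epsilon> A)"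
      using nat_trans_natural[OF n\<epsilon> A B h] by simp
    have SOD: "onOb (shriek_Ch X Y f) A \<in> Ob (Der Y)" "onOb (shriek_Ch X Y f) B \<in> Ob (Der Y)"
      using SO A B by (simp_all add: DerOb)
    \<comment> \<open>The composite of \<open>\<epsilon> B\<close> with L h is an arrow by typing
      alone. Naturality rewrites it to a composite starting from \<open>\<epsilon> A\<close>, and
      its being an arrow then types f_! h.\<close>
    have "Comp (Der Y) (onArr ?QY ?Sh) (\<epsilon> A) \<in> Hom (Der Y) (onOb L A) (onOb (shriek_Ch X Y f) B)"
      using Comp_in_Hom[OF pcDY LO[OF A] LO[OF B] SOD(2) LQh \<epsilon>H[OF B]] by (simp add: nat)
    then have "?Sh \<in> Hom (Ch Y) (Src (Ch Y) ?Sh) (Tgt (Ch Y) ?Sh)"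
      using Hom_if_Comp_loc_functor[OF is_precategory_Ch] unfolding Der_def by blast
    moreover have "Src (Ch Y) ?Sh = onOb (shriek_Ch X Y f) A" "Tgt (Ch Y) ?Sh = onOb (shriek_Ch X Y f) B"
      using h by (auto simp: Hom_Ch shriek_Ch_def)
    ultimately have Sh: "?Sh \<in> Hom (Ch Y) (onOb (shriek_Ch X Y f) A) (onOb (shriek_Ch X Y f) B)"
      by simp
    have QSh: "onArr ?QY ?Sh \<in> Hom (Der Y) (onOb (shriek_Ch X Y f) A) (onOb (shriek_Ch X Y f) B)"
      using functor_Hom[OF is_functor_loc_functor[OF is_precategory_Ch] SO[OF A] SO[OF B] Sh]
      by (simp add: Der_def)
    have "Comp (Der ?YC) (onArr (restrict_D Y C) (\<epsilon> B)) (onArr (restrict_D Y C) (onArr L (onArr ?QX h)))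
        = Comp (Der ?YC) (onArr (restrict_D Y C) (onArr ?QY ?Sh)) (onArr (restrict_D Y C) (\<epsilon> A))"
      unfolding functor_Comp[OF fD LO[OF A] LO[OF B] SOD(2) LQh \<epsilon>H[OF B], symmetric] nat
      by (rule functor_Comp[OF fD LO[OF A] SOD \<epsilon>H[OF A] QSh])
    moreover have "onArr (restrict_D Y C) (onArr ?QY ?Sh) = onArr ?QC (onArr (restrict_Ch Y C) ?Sh)"
      unfolding inv_image_D_def
      by (rule onArr_induced_loc_functor[OF is_functor_inv_image_Ch[OF cont]
            inv_image_Ch_quasi_isos[OF cont] SO[OF A] SO[OF B] Sh])
    ultimately show ?thesis
      using A B by (simp add: shriek_Ch_restrict_Arr[OF C U])
  qed
qed simp

text \<open>The condition \<open>is_base_change\<close> is the terminality clause of a left derived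
  functor: the derived functor is \<open>LC\<close> after restriction to \<open>U\<close>, and the
  competitor is restriction to \<open>C\<close> after \<open>L\<close>, equipped with the restricted
  \<epsilon>.\<close>

lemma base_change_exists_unique:
  assumes f: "continuous_map X Y f" and C: "closedin Y C" and U: "U = {x \<in> topspace X. f x \<in> C}"
    and L: "derived_shriek X Y f L \<epsilon>"
    and LC: "derived_shriek (subtopology X U) (subtopology Y C) f LC \<epsilon>C"
  shows "\<exists>!\<beta>. is_base_change X Y U C L \<epsilon> LC \<epsilon>C \<beta>"
proof -
  let ?XU = "subtopology X U" and ?YC = "subtopology Y C"
  have UX: "closedin X U" unfolding U by (rule closedin_continuous_map_preimage[OF f C])
  note contU = continuous_U[OF UX] and contC = continuous_U[OF C]
  have fL: "is_functor (Der X) (Der Y) L"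
    and n\<epsilon>: "nat_trans (Ch X) (Der Y) (L \<cdot>\<^sub>F loc_functor (Ch X) (quasi_isos X))
      (loc_functor (Ch Y) (quasi_isos Y) \<cdot>\<^sub>F shriek_Ch X Y f) \<epsilon>"
    using L by (simp_all add: derived_shriek_def is_left_derived_def Der_def)
  have "is_left_derived (Ch X) (quasi_isos X) (Ch ?YC) (quasi_isos ?YC)
      (shriek_Ch ?XU ?YC f \<cdot>\<^sub>F restrict_Ch X U) (LC \<cdot>\<^sub>F restrict_D X U)
      (\<lambda>A\<in>Ob (Ch X). \<epsilon>C (onOb (restrict_Ch X U) A))"
    unfolding inv_image_D_def
  proof (rule is_left_derived_reflector[where E = "ext_Ch X U" and u = "ext_unit X U"])
    show "is_left_derived (Ch ?XU) (quasi_isos ?XU) (Ch ?YC) (quasi_isos ?YC) (shriek_Ch ?XU ?YC f) LC \<epsilon>C"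
      using LC by (simp add: derived_shriek_def)
    show "onOb (restrict_Ch X U) (onOb (ext_Ch X U) B) = B" if "B \<in> Ob (Ch ?XU)" for B
      using that by (simp add: onOb_ext_Ch[OF UX] onOb_inv_image_Ch[OF contU] restrict_ext_complex[OF UX])
    show "ext_unit X U A \<in> Hom (Ch X) A (onOb (ext_Ch X U) (onOb (restrict_Ch X U) A))"
      if "A \<in> Ob (Ch X)" for A
      using that ext_unit_Hom[OF UX] by (simp add: onOb_ext_Ch[OF UX])
  qed (simp_all only: is_precategory_Ch is_functor_inv_image_Ch[OF contU] inv_image_Ch_quasi_isos[OF contU]
      is_functor_ext_Ch[OF UX] ext_Ch_quasi_isos[OF UX] restrict_ext_Ch[OF UX] ext_unit_natural[OF UX]
      restrict_ext_unit[OF UX] Ob_Ch mem_Collect_eq)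
  \<comment> \<open>Terminality at this competitor; \<open>restrict_derived_shriek_nat_trans\<close>
    supplies the transformation that it must carry.\<close>
  then have "\<exists>!\<beta>. nat_trans (Der X) (Der ?YC) (restrict_D Y C \<cdot>\<^sub>F L) (LC \<cdot>\<^sub>F restrict_D X U) \<beta> \<and>
      (\<forall>A\<in>Ob (Ch X). Comp (Der ?YC) ((\<lambda>A\<in>Ob (Ch X). \<epsilon>C (onOb (restrict_Ch X U) A)) A) (\<beta> A)
        = (\<lambda>A\<in>Ob (Ch X). onArr (restrict_D Y C) (\<epsilon> A)) A)"
    using is_functor_compF[OF fL is_functor_inv_image_D[OF contC]]
      restrict_derived_shriek_nat_trans[OF C U fL n\<epsilon>]
    unfolding is_left_derived_def Der_def by blast
  then show ?thesis
    by (simp add: is_base_change_def inv_image_D_def cong: ball_cong_simp)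
qed

text \<open>Naturality alone would not single out a morphism, as the zero transformation is natural
  too. So \<beta> is fixed by lying over the identification of the underived functors, and m by its
  transpose.\<close>

theorem proposition4p3p25:
  fixes X :: "'x topology" and Y :: "'y topology" and f :: "'x \<Rightarrow> 'y" and C :: "'y set"
    and L LC :: "('x, 'y, 'u) d_functor" and S SC :: "('y, 'x, 'u) d_functor"
    and \<epsilon> \<epsilon>C :: "('x, 'u) dcomplex \<Rightarrow> ('y, 'u) d_arr"
    and \<eta> \<eta>C :: "('y, 'u) dcomplex \<Rightarrow> ('y, 'u) d_arr"
  assumes "infinite (UNIV :: 'u set)"
    and "finite (topspace X)" and "finite (topspace Y)" and "continuous_map X Y f"
    and "closedin Y C"
    and U: "U = {x \<in> topspace X. f x \<in> C}"
    and XU: "XU = subtopology X U" and YC: "YC = subtopology Y C"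
    and "derived_shriek X Y f L \<epsilon>"
    and "derived_shriek XU YC f LC \<epsilon>C"
    and "is_left_adjoint (Der X) (Der Y) L S \<eta>"
    and "is_left_adjoint (Der XU) (Der YC) LC SC \<eta>C"
  shows "(\<exists>!\<beta>. is_base_change X Y U C L \<epsilon> LC \<epsilon>C \<beta>) \<and>
    (\<forall>\<beta>. is_base_change X Y U C L \<epsilon> LC \<epsilon>C \<beta> \<longrightarrow>
      (\<exists>!m. nat_trans (Der Y) (Der XU) (SC \<cdot>\<^sub>F restrict_D Y C) (restrict_D X U \<cdot>\<^sub>F S) m \<and>
        (\<forall>K\<in>Ob (Der Y).
          Comp (Der YC) (onArr LC (m K)) (\<eta>C (onOb (restrict_D Y C) K))
          = Comp (Der YC) (\<beta> (onOb S K)) (onArr (restrict_D Y C) (\<eta> K)))))"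
proof (intro conjI allI impI)
  show "\<exists>!\<beta>. is_base_change X Y U C L \<epsilon> LC \<epsilon>C \<beta>"
    using assms by (intro base_change_exists_unique) simp_all
next
  fix \<beta> assume "is_base_change X Y U C L \<epsilon> LC \<epsilon>C \<beta>"
  then have \<beta>: "nat_trans (Der X) (Der YC) (restrict_D Y C \<cdot>\<^sub>F L) (LC \<cdot>\<^sub>F restrict_D X U) \<beta>"
    by (simp add: is_base_change_def YC)
  have UX: "closedin X U" unfolding U by (rule closedin_continuous_map_preimage) fact+
  have cat: "is_category (Der T)" for T :: "'z topology"
    unfolding Der_def by (intro is_category_localization is_precategory_Ch)
  show "\<exists>!m. nat_trans (Der Y) (Der XU) (SC \<cdot>\<^sub>F restrict_D Y C) (restrict_D X U \<cdot>\<^sub>F S) m \<and>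
      (\<forall>K\<in>Ob (Der Y).
        Comp (Der YC) (onArr LC (m K)) (\<eta>C (onOb (restrict_D Y C) K))
        = Comp (Der YC) (\<beta> (onOb S K)) (onArr (restrict_D Y C) (\<eta> K)))"
  \<comment> \<open>The derived functors of f_! are the right adjoints here: \<open>L\<close> and
    \<open>LC\<close> take the places of R and R', \<open>S\<close> and \<open>SC\<close> those of S
    and S', and the restrictions to \<open>C\<close> and \<open>U\<close> those of P and Q.\<close>
  proof (rule mate_exists_unique)
    show "is_left_adjoint (Der X) (Der Y) L S \<eta>" "is_left_adjoint (Der XU) (Der YC) LC SC \<eta>C" by fact+
    show "is_functor (Der Y) (Der YC) (restrict_D Y C)" "is_functor (Der X) (Der XU) (restrict_D X U)"
      unfolding XU YC by (intro is_functor_inv_image_D continuous_U UX \<open>closedin Y C\<close>)+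
  qed (fact cat \<beta>)+
qed

end
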